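(* Let $G$ be a compact real Lie group or a compact $p$-adic Lie group, endowed with a compatible metric. Then there exists a subset $R\subseteq G$ such that $R^2=G$ and $\overline{\dim}\,R=(\dim G)/2$.
   Context: For a (nonempty) bounded metric space $X$ and $\delta>0$, the $\delta$-packing number $N_\delta(X)$ is the maximum number of pairwise disjoint open balls of radius $\delta$ in $X$. The upper Minkowski dimension of $X$ is $\overline{\dim}\,X=\limsup_{\delta\to0^+}\frac{-\log N_\delta(X)}{\log\delta}$. Subsets of $G$ carry the restricted metric. A metric $d$ on a compact real (resp. $p$-adic) Lie group $G$ is compatible if it is invariant under left and right translations by $G$ and there is a coordinate map (chart) from some open neighborhood of the identity $e$ to an open subset of $\mathbb{R}^n$ (resp. $\mathbb{Q}_p^n$) which is bi-Lipschitz on some neighborhood of $e$. Here $\mathbb{R}^n$ has its usual metric and $\mathbb{Q}_p^n$ has the maximum metric coming from $|x-y|_p$, with $|p|_p=1/p$. $\dim G$ is the dimension of $G$ as a real (resp. $p$-adic analytic) manifold. For $R\subseteq G$, $R^2=\{rs\mid r,s\in R\}$; a subset $R$ with $R^2=G$ is called a square root of $G$. *)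

theory Defs
  imports "HOL-Analysis.Analysis" "HOL-Algebra.Coset" "Berlekamp_Zassenhaus.Finite_Field"
begin

section \<open>The field of p-adic numbers\<close>

text \<open>
  The completion of the rationals with respect to the p-adic absolute value, as the ring of
  Cauchy sequences modulo the null sequences. The prime is encoded in the type, as for
  \<open>'p mod_ring\<close>: \<open>'p padic\<close> is the field of p-adic numbers for the prime
  \<open>p = CARD('p)\<close>.
\<close>

definition padic_val :: "nat \<Rightarrow> rat \<Rightarrow> int" where
  "padic_val p q = (case quotient_of q of (a, b) \<Rightarrow>
     int (multiplicity (int p) a) - int (multiplicity (int p) b))"

definition padic_abs :: "nat \<Rightarrow> rat \<Rightarrow> real" where
  "padic_abs p q = (if q = 0 then 0 else real p powi (- padic_val p q))"

definition padic_vanishes :: "nat \<Rightarrow> (nat \<Rightarrow> rat) \<Rightarrow> bool" where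
  "padic_vanishes p X \<longleftrightarrow> (\<lambda>n. padic_abs p (X n)) \<longlonglongrightarrow> 0"

definition padic_Cauchy :: "nat \<Rightarrow> (nat \<Rightarrow> rat) \<Rightarrow> bool" where
  "padic_Cauchy p X \<longleftrightarrow>
     (\<forall>e>0. \<exists>N. \<forall>m\<ge>N. \<forall>n\<ge>N. padic_abs p (X m - X n) < e)"

lemma padic_val_frac:
  assumes p: "prime p" and "a \<noteq> 0" "b \<noteq> 0"
  shows "padic_val p (of_int a / of_int b) =
    int (multiplicity (int p) a) - int (multiplicity (int p) b)"
proof -
  obtain c d where cd: "quotient_of (of_int a / of_int b) = (c, d)"
    by (cases "quotient_of (of_int a / of_int b)")
  have d: "d > 0" using quotient_of_denom_pos[OF cd] .
  have eq: "(of_int a / of_int b :: rat) = of_int c / of_int d" using quotient_of_div[OF cd] .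
  have "(of_int (a * d) :: rat) = of_int (c * b)"
    using eq d assms by (simp add: field_simps)
  hence ad: "a * d = c * b" by (simp only: of_int_eq_iff)
  hence "c \<noteq> 0" using assms d by auto
  have pe: "prime_elem (int p)" using p by simp
  have "multiplicity (int p) (a * d) = multiplicity (int p) (c * b)" using ad by simp
  hence "multiplicity (int p) a + multiplicity (int p) d = multiplicity (int p) c + multiplicity (int p) b"
    using \<open>c \<noteq> 0\<close> assms d pe by (simp add: prime_elem_multiplicity_mult_distrib)
  thus ?thesis by (simp add: padic_val_def cd)
qed

lemma padic_rat_frac: obtains a b where "b \<noteq> 0" "(q::rat) = of_int a / of_int b"
proof -
  obtain a b where "quotient_of q = (a, b)" by (cases "quotient_of q")
  thus ?thesis using that[of b a] quotient_of_div[of q a b] quotient_of_denom_pos[of q a b] by simp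
qed

lemma padic_rat_frac2:
  obtains a b c where "c \<noteq> 0" "(q::rat) = of_int a / of_int c" "(r::rat) = of_int b / of_int c"
proof -
  obtain a b where 1: "b \<noteq> 0" "q = of_int a / of_int b" by (rule padic_rat_frac)
  obtain c d where 2: "d \<noteq> 0" "r = of_int c / of_int d" by (rule padic_rat_frac)
  show ?thesis
    by (rule that[of "b * d" "a * d" "c * b"]) (use 1 2 in \<open>auto simp: field_simps\<close>)
qed

context
  fixes p :: nat
  assumes p: "prime p"
begin

lemma padic_abs_0 [simp]: "padic_abs p 0 = 0"
  by (simp add: padic_abs_def)

lemma padic_p_gt_1: "real p > 1"
  using p prime_gt_1_nat by force

lemma padic_abs_pos: "q \<noteq> 0 \<Longrightarrow> padic_abs p q > 0"
  using padic_p_gt_1 by (simp add: padic_abs_def)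

lemma padic_abs_nonneg [simp]: "padic_abs p q \<ge> 0"
  using padic_abs_pos[of q] by (cases "q = 0") auto

lemma padic_abs_eq_0 [simp]: "padic_abs p q = 0 \<longleftrightarrow> q = 0"
  using padic_abs_pos[of q] by (cases "q = 0") auto

lemma padic_abs_mult: "padic_abs p (q * r) = padic_abs p q * padic_abs p r"
proof (cases "q = 0 \<or> r = 0")
  case False
  obtain a b where 1: "b \<noteq> 0" "q = of_int a / of_int b" by (rule padic_rat_frac)
  obtain c d where 2: "d \<noteq> 0" "r = of_int c / of_int d" by (rule padic_rat_frac)
  have nz: "a \<noteq> 0" "c \<noteq> 0" using False 1 2 by auto
  have qr: "q * r = of_int (a * c) / of_int (b * d)" using 1 2 by simp
  have "padic_val p (q * r) = padic_val p q + padic_val p r"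
    unfolding qr unfolding 1(2) 2(2)
    using 1(1) 2(1) nz p
    by (simp add: padic_val_frac[OF p] prime_elem_multiplicity_mult_distrib
             del: of_int_mult of_int_add)
  thus ?thesis using False padic_p_gt_1
    by (simp add: padic_abs_def power_int_add[symmetric])
qed auto

lemma padic_abs_1 [simp]: "padic_abs p 1 = 1"
  using padic_abs_mult[of 1 1] padic_abs_pos[of 1] by simp

lemma padic_abs_minus [simp]: "padic_abs p (- q) = padic_abs p q"
proof -
  have "padic_abs p (-1) * padic_abs p (-1) = 1"
    using padic_abs_mult[of "-1" "-1"] by simp
  hence "padic_abs p (-1) = 1"
    by (metis abs_of_nonneg padic_abs_nonneg real_sqrt_abs2 real_sqrt_one)
  thus ?thesis using padic_abs_mult[of "-1" q] by simp
qed

lemma padic_abs_minus_commute: "padic_abs p (q - r) = padic_abs p (r - q)"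
  using padic_abs_minus[of "q - r"] by simp

lemma padic_abs_inverse: "padic_abs p (inverse q) = inverse (padic_abs p q)"
proof (cases "q = 0")
  case False
  hence "padic_abs p q * padic_abs p (inverse q) = 1"
    using padic_abs_mult[of q "inverse q"] by simp
  thus ?thesis using inverse_unique by metis
qed auto

lemma padic_abs_add: "padic_abs p (q + r) \<le> max (padic_abs p q) (padic_abs p r)"
proof (cases "q = 0 \<or> r = 0 \<or> q + r = 0")
  case True
  thus ?thesis by (auto simp: le_max_iff_disj)
next
  case False
  obtain a b c where 1: "c \<noteq> 0" "q = of_int a / of_int c" "r = of_int b / of_int c"
    by (rule padic_rat_frac2)
  have s: "q + r = of_int (a + b) / of_int c" using 1 by (simp add: add_divide_distrib)
  have nz: "a \<noteq> 0" "b \<noteq> 0" "a + b \<noteq> 0" using False 1 s by auto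
  define k where "k = min (multiplicity (int p) a) (multiplicity (int p) b)"
  have "int p ^ k dvd a" "int p ^ k dvd b"
    unfolding k_def by (auto intro: multiplicity_dvd')
  hence "int p ^ k dvd a + b" by simp
  moreover have "\<not> is_unit (int p)" using p by (auto simp: prime_nat_iff)
  ultimately have "k \<le> multiplicity (int p) (a + b)"
    using nz by (intro multiplicity_geI) auto
  hence "min (padic_val p q) (padic_val p r) \<le> padic_val p (q + r)"
    unfolding s unfolding 1 using 1(1) nz unfolding k_def
    by (simp add: padic_val_frac[OF p] del: of_int_mult of_int_add)
  hence "- padic_val p (q + r) \<le> - padic_val p q \<or> - padic_val p (q + r) \<le> - padic_val p r"
    by linarith
  thus ?thesis using False padic_p_gt_1
    by (auto simp: padic_abs_def le_max_iff_disj intro!: power_int_increasing)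
qed

lemma padic_abs_diff: "padic_abs p (q - r) \<le> max (padic_abs p q) (padic_abs p r)"
  using padic_abs_add[of q "- r"] by simp

lemma padic_abs_triangle: "padic_abs p (q + r) \<le> padic_abs p q + padic_abs p r"
  using padic_abs_add[of q r] padic_abs_nonneg[of q] padic_abs_nonneg[of r] by linarith

lemma padic_abs_abs_diff: "\<bar>padic_abs p q - padic_abs p r\<bar> \<le> padic_abs p (q - r)"
  using padic_abs_triangle[of "q - r" r] padic_abs_triangle[of "r - q" q]
  by (simp add: padic_abs_minus_commute)

lemma padic_vanishes_add:
  assumes "padic_vanishes p X" "padic_vanishes p Y"
  shows "padic_vanishes p (\<lambda>n. X n + Y n)"
  unfolding padic_vanishes_def
proof (rule Lim_null_comparison)
  show "(\<lambda>n. padic_abs p (X n) + padic_abs p (Y n)) \<longlonglongrightarrow> 0"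
    using tendsto_add[of "\<lambda>n. padic_abs p (X n)" 0 sequentially "\<lambda>n. padic_abs p (Y n)" 0] assms
    by (simp add: padic_vanishes_def)
qed (simp add: padic_abs_triangle)

lemma padic_vanishes_minus: "padic_vanishes p X \<Longrightarrow> padic_vanishes p (\<lambda>n. - X n)"
  by (simp add: padic_vanishes_def)

lemma padic_vanishes_minus_commute:
  "padic_vanishes p (\<lambda>n. X n - Y n) \<Longrightarrow> padic_vanishes p (\<lambda>n. Y n - X n)"
  by (simp add: padic_vanishes_def padic_abs_minus_commute)

lemma padic_vanishes_mult_bounded:
  assumes B: "eventually (\<lambda>n. padic_abs p (X n) \<le> B) sequentially" and "padic_vanishes p Y"
  shows "padic_vanishes p (\<lambda>n. X n * Y n)"
  unfolding padic_vanishes_def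
proof (rule Lim_null_comparison)
  show "(\<lambda>n. B * padic_abs p (Y n)) \<longlonglongrightarrow> 0"
    using tendsto_mult_left[of "\<lambda>n. padic_abs p (Y n)" 0 sequentially B] assms(2)
    by (simp add: padic_vanishes_def)
qed (use B in \<open>auto elim!: eventually_mono simp: padic_abs_mult mult_right_mono\<close>)

lemma padic_vanishes_const_iff: "padic_vanishes p (\<lambda>n. c) \<longleftrightarrow> c = 0"
  by (simp add: padic_vanishes_def LIMSEQ_const_iff)

lemma padic_Cauchy_const: "padic_Cauchy p (\<lambda>n. c)"
  by (simp add: padic_Cauchy_def)

lemma padic_Cauchy_add:
  assumes "padic_Cauchy p X" "padic_Cauchy p Y"
  shows "padic_Cauchy p (\<lambda>n. X n + Y n)"
  unfolding padic_Cauchy_def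
proof (intro allI impI)
  fix e :: real assume "e > 0"
  obtain N where N: "\<And>m n. m \<ge> N \<Longrightarrow> n \<ge> N \<Longrightarrow> padic_abs p (X m - X n) < e"
    using assms(1) \<open>e > 0\<close> unfolding padic_Cauchy_def by meson
  obtain M where M: "\<And>m n. m \<ge> M \<Longrightarrow> n \<ge> M \<Longrightarrow> padic_abs p (Y m - Y n) < e"
    using assms(2) \<open>e > 0\<close> unfolding padic_Cauchy_def by meson
  show "\<exists>N. \<forall>m\<ge>N. \<forall>n\<ge>N. padic_abs p (X m + Y m - (X n + Y n)) < e"
  proof (intro exI allI impI)
    fix m n assume "m \<ge> max N M" "n \<ge> max N M"
    thus "padic_abs p (X m + Y m - (X n + Y n)) < e"
      using padic_abs_add[of "X m - X n" "Y m - Y n"] N[of m n] M[of m n]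
      by (simp add: add_diff_add)
  qed
qed

lemma padic_Cauchy_minus: "padic_Cauchy p X \<Longrightarrow> padic_Cauchy p (\<lambda>n. - X n)"
  unfolding padic_Cauchy_def minus_diff_minus padic_abs_minus .

lemma padic_Cauchy_imp_convergent:
  assumes "padic_Cauchy p X"
  shows "convergent (\<lambda>n. padic_abs p (X n))"
  unfolding Cauchy_convergent_iff[symmetric] Cauchy_def
proof (intro allI impI)
  fix e :: real assume "e > 0"
  obtain N where N: "\<And>m n. m \<ge> N \<Longrightarrow> n \<ge> N \<Longrightarrow> padic_abs p (X m - X n) < e"
    using assms \<open>e > 0\<close> unfolding padic_Cauchy_def by meson
  show "\<exists>M. \<forall>m\<ge>M. \<forall>n\<ge>M. dist (padic_abs p (X m)) (padic_abs p (X n)) < e"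
    using N padic_abs_abs_diff unfolding dist_real_def by (meson le_less_trans)
qed

lemma padic_Cauchy_bounded:
  assumes "padic_Cauchy p X"
  obtains B where "B > 0" "\<And>n. padic_abs p (X n) \<le> B"
proof -
  have "Bseq (\<lambda>n. padic_abs p (X n))"
    using padic_Cauchy_imp_convergent[OF assms] by (rule convergent_imp_Bseq)
  thus ?thesis using that by (auto simp: Bseq_def)
qed

lemma padic_Cauchy_mult:
  assumes "padic_Cauchy p X" "padic_Cauchy p Y"
  shows "padic_Cauchy p (\<lambda>n. X n * Y n)"
  unfolding padic_Cauchy_def
proof (intro allI impI)
  fix e :: real assume "e > 0"
  obtain B where B: "B > 0" "\<And>n. padic_abs p (X n) \<le> B"
    by (rule padic_Cauchy_bounded[OF assms(1)]) (use that in blast)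
  obtain C where C: "C > 0" "\<And>n. padic_abs p (Y n) \<le> C"
    by (rule padic_Cauchy_bounded[OF assms(2)]) (use that in blast)
  obtain N where N: "\<And>m n. m \<ge> N \<Longrightarrow> n \<ge> N \<Longrightarrow> padic_abs p (X m - X n) < e / C"
    using assms(1) \<open>e > 0\<close> C unfolding padic_Cauchy_def by (meson divide_pos_pos)
  obtain M where M: "\<And>m n. m \<ge> M \<Longrightarrow> n \<ge> M \<Longrightarrow> padic_abs p (Y m - Y n) < e / B"
    using assms(2) \<open>e > 0\<close> B unfolding padic_Cauchy_def by (meson divide_pos_pos)
  show "\<exists>N. \<forall>m\<ge>N. \<forall>n\<ge>N. padic_abs p (X m * Y m - X n * Y n) < e"
  proof (intro exI allI impI)
    fix m n assume mn: "m \<ge> max N M" "n \<ge> max N M"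
    have "padic_abs p (X m * (Y m - Y n)) < e"
    proof -
      have "padic_abs p (X m * (Y m - Y n)) \<le> B * padic_abs p (Y m - Y n)"
        using B by (simp add: padic_abs_mult mult_right_mono)
      also have "\<dots> < B * (e / B)" using M[of m n] mn B by (intro mult_strict_left_mono) auto
      finally show ?thesis using B by simp
    qed
    moreover have "padic_abs p ((X m - X n) * Y n) < e"
    proof -
      have "padic_abs p ((X m - X n) * Y n) \<le> padic_abs p (X m - X n) * C"
        using C by (simp add: padic_abs_mult mult_left_mono)
      also have "\<dots> < e / C * C" using N[of m n] mn C by (intro mult_strict_right_mono) auto
      finally show ?thesis using C by simp
    qed
    ultimately show "padic_abs p (X m * Y m - X n * Y n) < e"
      unfolding mult_diff_mult using padic_abs_add[of "X m * (Y m - Y n)" "(X m - X n) * Y n"]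
      by linarith
  qed
qed

lemma padic_Cauchy_not_vanishes:
  assumes "padic_Cauchy p X" "\<not> padic_vanishes p X"
  obtains b where "b > 0" "eventually (\<lambda>n. padic_abs p (X n) > b) sequentially"
proof -
  obtain L where L: "(\<lambda>n. padic_abs p (X n)) \<longlonglongrightarrow> L"
    using padic_Cauchy_imp_convergent[OF assms(1)] by (auto simp: convergent_def)
  have "L \<ge> 0" by (rule LIMSEQ_le_const[OF L]) auto
  moreover have "L \<noteq> 0" using L assms(2) by (auto simp: padic_vanishes_def)
  ultimately have "L > 0" by simp
  show ?thesis
    by (rule that[of "L / 2"]) (use \<open>L > 0\<close> order_tendstoD(1)[OF L, of "L / 2"] in simp_all)
qed

lemma padic_abs_inverse_diff:
  assumes "x \<noteq> 0" "y \<noteq> 0"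
  shows "padic_abs p (inverse x - inverse y)
    = inverse (padic_abs p x) * padic_abs p (x - y) * inverse (padic_abs p y)"
  using assms by (simp add: inverse_diff_inverse padic_abs_mult padic_abs_inverse)

lemma padic_Cauchy_inverse:
  assumes "padic_Cauchy p X" "\<not> padic_vanishes p X"
  shows "padic_Cauchy p (\<lambda>n. inverse (X n))"
  unfolding padic_Cauchy_def
proof (intro allI impI)
  fix e :: real assume "e > 0"
  obtain b where b: "b > 0" "eventually (\<lambda>n. padic_abs p (X n) > b) sequentially"
    by (rule padic_Cauchy_not_vanishes[OF assms]) (use that in blast)
  then obtain M where M: "\<And>n. n \<ge> M \<Longrightarrow> padic_abs p (X n) > b"
    by (auto simp: eventually_sequentially)
  obtain N where N: "\<And>m n. m \<ge> N \<Longrightarrow> n \<ge> N \<Longrightarrow> padic_abs p (X m - X n) < b * e * b"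
    using assms(1) \<open>e > 0\<close> b unfolding padic_Cauchy_def by (meson mult_pos_pos)
  show "\<exists>N. \<forall>m\<ge>N. \<forall>n\<ge>N. padic_abs p (inverse (X m) - inverse (X n)) < e"
  proof (intro exI allI impI)
    fix m n assume mn: "m \<ge> max N M" "n \<ge> max N M"
    have "padic_abs p (X m) > b" "padic_abs p (X n) > b" using M mn by auto
    hence nz: "X m \<noteq> 0" "X n \<noteq> 0" using b by auto
    have "padic_abs p (inverse (X m) - inverse (X n))
       = inverse (padic_abs p (X m)) * padic_abs p (X m - X n) * inverse (padic_abs p (X n))"
      by (rule padic_abs_inverse_diff[OF nz])
    also have "\<dots> < inverse b * (b * e * b) * inverse b"
      using M[of m] M[of n] N[of m n] mn b
      by (intro mult_strict_mono' less_imp_inverse_less) (auto intro!: mult_nonneg_nonneg)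
    also have "\<dots> = e" using b by simp
    finally show "padic_abs p (inverse (X m) - inverse (X n)) < e" .
  qed
qed

lemma padic_vanishes_diff_inverse:
  assumes "padic_Cauchy p X" "\<not> padic_vanishes p X"
    and "padic_Cauchy p Y" "\<not> padic_vanishes p Y"
    and "padic_vanishes p (\<lambda>n. X n - Y n)"
  shows "padic_vanishes p (\<lambda>n. inverse (X n) - inverse (Y n))"
proof -
  obtain b where b: "b > 0" "eventually (\<lambda>n. padic_abs p (X n) > b) sequentially"
    by (rule padic_Cauchy_not_vanishes[OF assms(1,2)]) (use that in blast)
  obtain c where c: "c > 0" "eventually (\<lambda>n. padic_abs p (Y n) > c) sequentially"
    by (rule padic_Cauchy_not_vanishes[OF assms(3,4)]) (use that in blast)
  show ?thesis unfolding padic_vanishes_def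
  proof (rule Lim_null_comparison)
    show "(\<lambda>n. inverse b * padic_abs p (X n - Y n) * inverse c) \<longlonglongrightarrow> 0"
      using assms(5) unfolding padic_vanishes_def by (auto intro!: tendsto_eq_intros)
    show "eventually (\<lambda>n. norm (padic_abs p (inverse (X n) - inverse (Y n)))
        \<le> inverse b * padic_abs p (X n - Y n) * inverse c) sequentially"
      using b(2) c(2)
    proof eventually_elim
      case (elim n)
      hence nz: "X n \<noteq> 0" "Y n \<noteq> 0" using b c by auto
      show ?case using elim b c
        by (simp only: padic_abs_inverse_diff[OF nz] norm_mult norm_inverse real_norm_def)
           (auto intro!: mult_mono le_imp_inverse_le mult_nonneg_nonneg)
    qed
  qed
qed

end


typedef (overloaded) ('p::prime_card) padic_seq = "{X. padic_Cauchy CARD('p) X}"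
  using padic_Cauchy_const[OF prime_card] by blast

setup_lifting type_definition_padic_seq

instantiation padic_seq :: (prime_card) comm_ring
begin

lift_definition zero_padic_seq :: "'a padic_seq" is "\<lambda>_. 0"
  by (rule padic_Cauchy_const[OF prime_card])

lift_definition plus_padic_seq :: "'a padic_seq \<Rightarrow> 'a padic_seq \<Rightarrow> 'a padic_seq"
  is "\<lambda>X Y n. X n + Y n"
  by (rule padic_Cauchy_add[OF prime_card])

lift_definition uminus_padic_seq :: "'a padic_seq \<Rightarrow> 'a padic_seq" is "\<lambda>X n. - X n"
  by (rule padic_Cauchy_minus[OF prime_card])

lift_definition minus_padic_seq :: "'a padic_seq \<Rightarrow> 'a padic_seq \<Rightarrow> 'a padic_seq"
  is "\<lambda>X Y n. X n - Y n"
  unfolding diff_conv_add_uminus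
  by (intro padic_Cauchy_add[OF prime_card] padic_Cauchy_minus[OF prime_card])

lift_definition times_padic_seq :: "'a padic_seq \<Rightarrow> 'a padic_seq \<Rightarrow> 'a padic_seq"
  is "\<lambda>X Y n. X n * Y n"
  by (rule padic_Cauchy_mult[OF prime_card])

instance
  by standard (transfer; simp add: algebra_simps)+

end

lift_definition padic_seq_const :: "rat \<Rightarrow> 'p::prime_card padic_seq" is "\<lambda>q _. q"
  by (rule padic_Cauchy_const[OF prime_card])

lift_definition padic_null :: "'p::prime_card padic_seq \<Rightarrow> bool" is "padic_vanishes CARD('p)" .

lift_definition padic_seq_inverse :: "'p::prime_card padic_seq \<Rightarrow> 'p padic_seq"
  is "\<lambda>X. if padic_vanishes CARD('p) X then (\<lambda>_. 0) else (\<lambda>n. inverse (X n))"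
  by (simp add: padic_Cauchy_const[OF prime_card] padic_Cauchy_inverse[OF prime_card])

lift_definition padic_seq_norm :: "'p::prime_card padic_seq \<Rightarrow> real"
  is "\<lambda>X. lim (\<lambda>n. padic_abs CARD('p) (X n))" .

lemma padic_null_0 [simp]: "padic_null (0 :: 'p::prime_card padic_seq)"
  by transfer (simp add: padic_vanishes_const_iff[OF prime_card])

lemma padic_null_add:
  "padic_null X \<Longrightarrow> padic_null Y \<Longrightarrow> padic_null (X + Y :: 'p::prime_card padic_seq)"
  by transfer (rule padic_vanishes_add[OF prime_card])

lemma padic_null_minus: "padic_null X \<Longrightarrow> padic_null (- X :: 'p::prime_card padic_seq)"
  by transfer (rule padic_vanishes_minus[OF prime_card])

lemma padic_null_minus_commute:
  "padic_null (X - Y) \<Longrightarrow> padic_null (Y - X :: 'p::prime_card padic_seq)"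
  using padic_null_minus[of "X - Y"] by simp

lemma padic_null_mult: "padic_null Y \<Longrightarrow> padic_null (X * Y :: 'p::prime_card padic_seq)"
proof transfer
  fix X Y :: "nat \<Rightarrow> rat"
  assume X: "padic_Cauchy CARD('p) X" and Y: "padic_vanishes CARD('p) Y"
  obtain B where "\<And>n. padic_abs CARD('p) (X n) \<le> B"
    by (rule padic_Cauchy_bounded[OF prime_card X]) (use that in blast)
  thus "padic_vanishes CARD('p) (\<lambda>n. X n * Y n)"
    by (intro padic_vanishes_mult_bounded[OF prime_card _ Y, where B = B] always_eventually) auto
qed

lemma padic_null_mult_right: "padic_null X \<Longrightarrow> padic_null (X * Y :: 'p::prime_card padic_seq)"
  using padic_null_mult[of X Y] by (simp add: mult.commute)

lemma padic_null_inverse_diff: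
  "padic_null (X - Y) \<Longrightarrow>
    padic_null (padic_seq_inverse X - padic_seq_inverse Y :: 'p::prime_card padic_seq)"
proof transfer
  fix X Y :: "nat \<Rightarrow> rat"
  assume X: "padic_Cauchy CARD('p) X" and Y: "padic_Cauchy CARD('p) Y"
    and XY: "padic_vanishes CARD('p) (\<lambda>n. X n - Y n)"
  have iff: "padic_vanishes CARD('p) X \<longleftrightarrow> padic_vanishes CARD('p) Y"
    using padic_vanishes_add[OF prime_card XY, of Y]
      padic_vanishes_add[OF prime_card padic_vanishes_minus_commute[OF prime_card XY], of X]
    by auto
  show "padic_vanishes CARD('p) (\<lambda>n.
      (if padic_vanishes CARD('p) X then \<lambda>_. 0 else (\<lambda>n. inverse (X n))) n -
      (if padic_vanishes CARD('p) Y then \<lambda>_. 0 else (\<lambda>n. inverse (Y n))) n)"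
    using padic_vanishes_diff_inverse[OF prime_card X _ Y _ XY]
    by (auto simp: iff padic_vanishes_const_iff[OF prime_card])
qed

lemma padic_seq_norm_tendsto:
  fixes X :: "'p::prime_card padic_seq"
  shows "(\<lambda>n. padic_abs CARD('p) (Rep_padic_seq X n)) \<longlonglongrightarrow> padic_seq_norm X"
  unfolding padic_seq_norm.rep_eq
  using Rep_padic_seq[of X] padic_Cauchy_imp_convergent[OF prime_card]
  by (simp add: convergent_LIMSEQ_iff)

lemma padic_seq_norm_nonneg: "padic_seq_norm (X :: 'p::prime_card padic_seq) \<ge> 0"
  by (rule LIMSEQ_le_const[OF padic_seq_norm_tendsto])
     (auto simp: padic_abs_nonneg[OF prime_card])

lemma padic_seq_norm_eq_0_iff:
  "padic_seq_norm (X :: 'p::prime_card padic_seq) = 0 \<longleftrightarrow> padic_null X"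
  using padic_seq_norm_tendsto[of X] LIMSEQ_unique
  by (force simp: padic_null.rep_eq padic_vanishes_def)

lemma padic_seq_norm_add:
  "padic_seq_norm (X + Y :: 'p::prime_card padic_seq) \<le> max (padic_seq_norm X) (padic_seq_norm Y)"
proof (rule LIMSEQ_le)
  show "(\<lambda>n. padic_abs CARD('p) (Rep_padic_seq (X + Y) n)) \<longlonglongrightarrow> padic_seq_norm (X + Y)"
    by (rule padic_seq_norm_tendsto)
  show "(\<lambda>n. max (padic_abs CARD('p) (Rep_padic_seq X n)) (padic_abs CARD('p) (Rep_padic_seq Y n)))
      \<longlonglongrightarrow> max (padic_seq_norm X) (padic_seq_norm Y)"
    by (intro tendsto_max padic_seq_norm_tendsto)
qed (simp add: plus_padic_seq.rep_eq padic_abs_add[OF prime_card])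

lemma padic_seq_norm_minus: "padic_seq_norm (- X :: 'p::prime_card padic_seq) = padic_seq_norm X"
  by transfer (simp add: padic_abs_minus[OF prime_card])

lemma padic_seq_norm_mult:
  "padic_seq_norm (X * Y :: 'p::prime_card padic_seq) = padic_seq_norm X * padic_seq_norm Y"
proof (rule LIMSEQ_unique)
  show "(\<lambda>n. padic_abs CARD('p) (Rep_padic_seq (X * Y) n)) \<longlonglongrightarrow> padic_seq_norm (X * Y)"
    by (rule padic_seq_norm_tendsto)
  show "(\<lambda>n. padic_abs CARD('p) (Rep_padic_seq (X * Y) n))
      \<longlonglongrightarrow> padic_seq_norm X * padic_seq_norm Y"
    unfolding times_padic_seq.rep_eq padic_abs_mult[OF prime_card]
    by (intro tendsto_mult padic_seq_norm_tendsto)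
qed

lemma padic_seq_norm_cong:
  assumes "padic_null (X - Y :: 'p::prime_card padic_seq)"
  shows "padic_seq_norm X = padic_seq_norm Y"
proof (rule antisym)
  show "padic_seq_norm X \<le> padic_seq_norm Y"
    using padic_seq_norm_add[of "X - Y" Y] assms padic_seq_norm_nonneg[of Y]
    by (simp flip: padic_seq_norm_eq_0_iff)
  show "padic_seq_norm Y \<le> padic_seq_norm X"
    using padic_seq_norm_add[of "Y - X" X] padic_null_minus_commute[OF assms]
      padic_seq_norm_nonneg[of X]
    by (simp flip: padic_seq_norm_eq_0_iff)
qed

definition padic_rel :: "'p::prime_card padic_seq \<Rightarrow> 'p padic_seq \<Rightarrow> bool" where
  "padic_rel X Y \<longleftrightarrow> padic_null (X - Y)"

lemma equivp_padic_rel: "equivp (padic_rel :: 'p::prime_card padic_seq \<Rightarrow> _)"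
proof (rule equivpI)
  show "reflp (padic_rel :: 'p padic_seq \<Rightarrow> _)"
    by (simp add: reflp_def padic_rel_def)
  show "symp (padic_rel :: 'p padic_seq \<Rightarrow> _)"
    using padic_null_minus_commute by (auto simp: symp_def padic_rel_def)
  show "transp (padic_rel :: 'p padic_seq \<Rightarrow> _)"
  proof (rule transpI)
    fix X Y Z :: "'p padic_seq" assume "padic_rel X Y" "padic_rel Y Z"
    thus "padic_rel X Z"
      using padic_null_add[of "X - Y" "Y - Z"] by (simp add: padic_rel_def)
  qed
qed

quotient_type (overloaded) 'p padic = "'p::prime_card padic_seq" / padic_rel
  by (rule equivp_padic_rel)

instantiation padic :: (prime_card) field
begin

lift_definition zero_padic :: "'a padic" is "0" .

lift_definition one_padic :: "'a padic" is "padic_seq_const 1" .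

lift_definition plus_padic :: "'a padic \<Rightarrow> 'a padic \<Rightarrow> 'a padic" is "(+)"
  unfolding padic_rel_def add_diff_add by (rule padic_null_add)

lift_definition uminus_padic :: "'a padic \<Rightarrow> 'a padic" is "uminus"
  unfolding padic_rel_def minus_diff_minus by (rule padic_null_minus)

lift_definition minus_padic :: "'a padic \<Rightarrow> 'a padic \<Rightarrow> 'a padic" is "(-)"
  unfolding padic_rel_def diff_conv_add_uminus
  using add_diff_add minus_diff_minus padic_null_add padic_null_minus
  by (metis (no_types, lifting) diff_conv_add_uminus)

lift_definition times_padic :: "'a padic \<Rightarrow> 'a padic \<Rightarrow> 'a padic" is "(*)"
  unfolding padic_rel_def mult_diff_mult
  by (intro padic_null_add padic_null_mult padic_null_mult_right)

lift_definition inverse_padic :: "'a padic \<Rightarrow> 'a padic" is padic_seq_inverse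
  unfolding padic_rel_def by (rule padic_null_inverse_diff)

definition divide_padic :: "'a padic \<Rightarrow> 'a padic \<Rightarrow> 'a padic" where
  "divide_padic x y = x * inverse y"

instance
proof
  fix a b c :: "'a padic"
  show "a + b + c = a + (b + c)" by transfer (simp add: padic_rel_def ac_simps)
  show "a + b = b + a" by transfer (simp add: padic_rel_def ac_simps)
  show "0 + a = a" by transfer (simp add: padic_rel_def)
  show "- a + a = 0" by transfer (simp add: padic_rel_def)
  show "a - b = a + - b" by transfer (simp add: padic_rel_def)
  show "a * b * c = a * (b * c)" by transfer (simp add: padic_rel_def ac_simps)
  show "a * b = b * a" by transfer (simp add: padic_rel_def ac_simps)
  have one: "padic_seq_const 1 * X = X" for X :: "'a padic_seq" by transfer simp
  show "1 * a = a" by transfer (simp add: padic_rel_def one)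
  show "(a + b) * c = a * c + b * c"
    by transfer (simp add: padic_rel_def distrib_right)
  show "(0 :: 'a padic) \<noteq> 1"
  proof transfer
    have "\<not> padic_null (0 - padic_seq_const 1 :: 'a padic_seq)"
      by transfer (simp add: padic_vanishes_const_iff[OF prime_card])
    thus "\<not> padic_rel 0 (padic_seq_const 1 :: 'a padic_seq)" by (simp add: padic_rel_def)
  qed
  have inv: "padic_null (padic_seq_inverse X * X - padic_seq_const 1)"
    if "\<not> padic_null X" for X :: "'a padic_seq"
    using that
  proof transfer
    fix X assume X: "padic_Cauchy CARD('a) X" "\<not> padic_vanishes CARD('a) X"
    obtain b where b: "b > 0" "eventually (\<lambda>n. padic_abs CARD('a) (X n) > b) sequentially"
      by (rule padic_Cauchy_not_vanishes[OF prime_card X]) (use that in blast)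
    have "eventually (\<lambda>n. inverse (X n) * X n - 1 = 0) sequentially"
      using b(2)
    proof eventually_elim
      case (elim n)
      hence "X n \<noteq> 0" using b(1) by (auto simp: padic_abs_0[OF prime_card])
      thus ?case by simp
    qed
    hence "eventually (\<lambda>n. padic_abs CARD('a) (inverse (X n) * X n - 1) = 0) sequentially"
      by eventually_elim (simp add: padic_abs_0[OF prime_card])
    thus "padic_vanishes CARD('a) (\<lambda>n. (if padic_vanishes CARD('a) X then \<lambda>_. 0
        else (\<lambda>n. inverse (X n))) n * X n - 1)"
      using X by (simp add: padic_vanishes_def tendsto_eventually)
  qed
  show "a \<noteq> 0 \<Longrightarrow> inverse a * a = 1"
    by transfer (use inv in \<open>auto simp: padic_rel_def\<close>)
  show "a div b = a * inverse b" by (rule divide_padic_def)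
  have "padic_null (padic_seq_inverse (0 :: 'a padic_seq))"
    by transfer (simp add: padic_vanishes_const_iff[OF prime_card])
  thus "inverse (0 :: 'a padic) = 0" by transfer (simp add: padic_rel_def)
qed

end

lift_definition padic_norm :: "'p::prime_card padic \<Rightarrow> real" is padic_seq_norm
  unfolding padic_rel_def by (rule padic_seq_norm_cong)

lemma padic_norm_nonneg [simp]: "padic_norm (x :: 'p::prime_card padic) \<ge> 0"
  by transfer (rule padic_seq_norm_nonneg)

lemma padic_norm_eq_0_iff [simp]: "padic_norm (x :: 'p::prime_card padic) = 0 \<longleftrightarrow> x = 0"
  by transfer (simp add: padic_seq_norm_eq_0_iff padic_rel_def)

lemma padic_norm_minus [simp]: "padic_norm (- x :: 'p::prime_card padic) = padic_norm x"
  by transfer (rule padic_seq_norm_minus)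

lemma padic_norm_add: "padic_norm (x + y :: 'p::prime_card padic) \<le> max (padic_norm x) (padic_norm y)"
  by transfer (rule padic_seq_norm_add)

lemma padic_norm_mult: "padic_norm (x * y :: 'p::prime_card padic) = padic_norm x * padic_norm y"
  by transfer (rule padic_seq_norm_mult)

instantiation padic :: (prime_card) metric_space
begin

definition dist_padic :: "'a padic \<Rightarrow> 'a padic \<Rightarrow> real" where
  "dist_padic x y = padic_norm (x - y)"

definition uniformity_padic :: "('a padic \<times> 'a padic) filter" where
  "uniformity_padic = (INF e\<in>{0<..}. principal {(x, y). dist x y < e})"

definition open_padic :: "'a padic set \<Rightarrow> bool" where
  "open_padic U \<longleftrightarrow> (\<forall>x\<in>U. eventually (\<lambda>(x', y). x' = x \<longrightarrow> y \<in> U) uniformity)"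

instance
proof
  fix x y z :: "'a padic"
  show "dist x y = 0 \<longleftrightarrow> x = y" by (simp add: dist_padic_def)
  show "dist x y \<le> dist x z + dist y z"
  proof -
    have "padic_norm (x - y) \<le> max (padic_norm (x - z)) (padic_norm (y - z))"
      using padic_norm_add[of "x - z" "z - y"] padic_norm_minus[of "y - z"] by simp
    thus ?thesis
      using padic_norm_nonneg[of "x - z"] padic_norm_nonneg[of "y - z"]
      unfolding dist_padic_def by linarith
  qed
qed (simp_all add: uniformity_padic_def open_padic_def)

end

lemma padic_seq_const_simps:
  "padic_seq_const 0 = (0 :: 'p::prime_card padic_seq)"
  "padic_seq_const (q + r) = (padic_seq_const q + padic_seq_const r :: 'p::prime_card padic_seq)"
  "padic_seq_const (q - r) = (padic_seq_const q - padic_seq_const r :: 'p::prime_card padic_seq)"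
  "padic_seq_const (q * r) = (padic_seq_const q * padic_seq_const r :: 'p::prime_card padic_seq)"
  by (transfer; simp)+

lift_definition padic_of_rat :: "rat \<Rightarrow> 'p::prime_card padic" is padic_seq_const .

lemma padic_of_rat_simps:
  "padic_of_rat 0 = (0 :: 'p::prime_card padic)"
  "padic_of_rat 1 = (1 :: 'p::prime_card padic)"
  "padic_of_rat (q + r) = (padic_of_rat q + padic_of_rat r :: 'p::prime_card padic)"
  "padic_of_rat (q - r) = (padic_of_rat q - padic_of_rat r :: 'p::prime_card padic)"
  "padic_of_rat (q * r) = (padic_of_rat q * padic_of_rat r :: 'p::prime_card padic)"
  by (transfer; simp add: padic_seq_const_simps padic_rel_def)+

lemma padic_norm_padic_of_rat: "padic_norm (padic_of_rat q :: 'p::prime_card padic) = padic_abs CARD('p) q"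
  by (transfer, transfer) (rule limI, simp)

instance padic :: (prime_card) field_char_0
proof (standard, rule injI)
  have of_nat: "(of_nat n :: 'a padic) = padic_of_rat (of_nat n)" for n
    by (induction n) (simp_all add: padic_of_rat_simps)
  fix m n :: nat assume "(of_nat m :: 'a padic) = of_nat n"
  hence "padic_norm (padic_of_rat (of_nat m - of_nat n) :: 'a padic) = 0"
    by (simp add: of_nat padic_of_rat_simps)
  thus "m = n"
    by (simp add: padic_norm_padic_of_rat padic_abs_eq_0[OF prime_card])
qed

lemma padic_of_rat_eq: "padic_of_rat q = (of_rat q :: 'p::prime_card padic)"
proof -
  have nat: "(padic_of_rat (of_nat n) :: 'p padic) = of_nat n" for n
    by (induction n) (simp_all add: padic_of_rat_simps)
  have minus: "(padic_of_rat (- r) :: 'p padic) = - padic_of_rat r" for r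
    using padic_of_rat_simps(4)[of 0 r, where 'p = 'p] by (simp add: padic_of_rat_simps(1))
  have int: "(padic_of_rat (of_int k) :: 'p padic) = of_int k" for k
    by (cases k rule: int_cases2) (simp_all add: nat minus)
  obtain a b where ab: "b \<noteq> 0" "q = of_int a / of_int b" by (rule padic_rat_frac)
  have "(padic_of_rat q :: 'p padic) * of_int b = of_int a"
    using padic_of_rat_simps(5)[of q "of_int b", where 'p = 'p] ab by (simp add: int)
  hence "(padic_of_rat q :: 'p padic) = of_int a / of_int b"
    using ab(1) by (simp add: eq_divide_eq)
  also have "\<dots> = of_rat q" by (simp add: ab(2) of_rat_divide)
  finally show ?thesis .
qed

lemma padic_norm_of_rat: "padic_norm (of_rat q :: 'p::prime_card padic) = padic_abs CARD('p) q"
  using padic_norm_padic_of_rat[of q, where 'p = 'p] by (simp add: padic_of_rat_eq)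

lemma of_rat_tendsto_padic:
  fixes X :: "'p::prime_card padic_seq"
  shows "(\<lambda>n. of_rat (Rep_padic_seq X n)) \<longlonglongrightarrow> abs_padic X"
  unfolding tendsto_iff eventually_sequentially
proof (intro allI impI)
  fix e :: real assume "e > 0"
  have "padic_Cauchy CARD('p) (Rep_padic_seq X)" using Rep_padic_seq[of X] by simp
  then obtain N where N: "\<And>m n. m \<ge> N \<Longrightarrow> n \<ge> N \<Longrightarrow>
      padic_abs CARD('p) (Rep_padic_seq X m - Rep_padic_seq X n) < e / 2"
    using half_gt_zero[OF \<open>e > 0\<close>] unfolding padic_Cauchy_def by meson
  show "\<exists>N. \<forall>n\<ge>N. dist (of_rat (Rep_padic_seq X n)) (abs_padic X) < e"
  proof (intro exI allI impI)
    fix n assume "n \<ge> N"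
    let ?q = "Rep_padic_seq X n"
    have "padic_seq_norm (padic_seq_const ?q - X) \<le> e / 2"
    proof (rule LIMSEQ_le_const2[OF padic_seq_norm_tendsto])
      show "\<exists>N. \<forall>m\<ge>N. padic_abs CARD('p) (Rep_padic_seq (padic_seq_const ?q - X) m) \<le> e / 2"
        using N[OF \<open>n \<ge> N\<close>]
        by (auto simp: minus_padic_seq.rep_eq padic_seq_const.rep_eq intro!: exI[of _ N] less_imp_le)
    qed
    moreover have "dist (of_rat ?q) (abs_padic X) = padic_seq_norm (padic_seq_const ?q - X)"
      unfolding dist_padic_def padic_of_rat_eq[symmetric]
      by (simp add: padic_of_rat.abs_eq minus_padic.abs_eq padic_norm.abs_eq)
    ultimately show "dist (of_rat ?q) (abs_padic X) < e" using \<open>e > 0\<close> by simp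
  qed
qed

lemma of_rat_dense_padic:
  fixes x :: "'p::prime_card padic"
  assumes "e > 0"
  obtains q where "dist (of_rat q) x < e"
proof -
  obtain X where X: "x = abs_padic X"
    by (rule that[OF Quotient3_abs_rep[OF Quotient3_padic, symmetric]])
  have "eventually (\<lambda>n. dist (of_rat (Rep_padic_seq X n)) x < e) sequentially"
    using of_rat_tendsto_padic[of X] assms unfolding X tendsto_iff by blast
  thus ?thesis using that by (auto simp: eventually_sequentially)
qed

instance padic :: (prime_card) complete_space
proof
  fix x :: "nat \<Rightarrow> 'a padic" assume x: "Cauchy x"
  have "\<exists>q. dist (of_rat q) (x n) < inverse (real (Suc n))" for n
    using of_rat_dense_padic[of "inverse (real (Suc n))" "x n"] by auto
  then obtain q where q: "\<And>n. dist (of_rat (q n)) (x n) < inverse (real (Suc n))" by metis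
  have lim: "(\<lambda>n. dist (of_rat (q n)) (x n)) \<longlonglongrightarrow> 0"
    by (rule Lim_null_comparison[OF _ LIMSEQ_inverse_real_of_nat])
       (use q in \<open>auto intro!: always_eventually less_imp_le\<close>)
  have "padic_Cauchy CARD('a) q"
    unfolding padic_Cauchy_def
  proof (intro allI impI)
    fix e :: real assume "e > 0"
    obtain M where M: "\<And>m n. m \<ge> M \<Longrightarrow> n \<ge> M \<Longrightarrow> dist (x m) (x n) < e / 3"
      using metric_CauchyD[OF x, of "e / 3"] \<open>e > 0\<close> by auto
    obtain N where N: "\<And>n. n \<ge> N \<Longrightarrow> dist (of_rat (q n)) (x n) < e / 3"
      using order_tendstoD(2)[OF lim, of "e / 3"] \<open>e > 0\<close> by (auto simp: eventually_sequentially)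
    show "\<exists>N. \<forall>m\<ge>N. \<forall>n\<ge>N. padic_abs CARD('a) (q m - q n) < e"
    proof (intro exI allI impI)
      fix m n assume mn: "m \<ge> max M N" "n \<ge> max M N"
      have "padic_abs CARD('a) (q m - q n) = dist (of_rat (q m) :: 'a padic) (of_rat (q n))"
        by (simp add: dist_padic_def of_rat_diff[symmetric] padic_norm_of_rat)
      also have "\<dots> \<le> dist (of_rat (q m)) (x m) + dist (x m) (x n) + dist (of_rat (q n)) (x n)"
        using dist_triangle[of "of_rat (q m)" "of_rat (q n)" "x m"]
          dist_triangle[of "x m" "of_rat (q n)" "x n"] by (simp add: dist_commute)
      also have "\<dots> < e" using M[of m n] N[of m] N[of n] mn by simp
      finally show "padic_abs CARD('a) (q m - q n) < e" .
    qed
  qed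
  hence "Rep_padic_seq (Abs_padic_seq q :: 'a padic_seq) = q"
    by (simp add: Abs_padic_seq_inverse)
  hence "(\<lambda>n. of_rat (q n)) \<longlonglongrightarrow> abs_padic (Abs_padic_seq q :: 'a padic_seq)"
    using of_rat_tendsto_padic[of "Abs_padic_seq q :: 'a padic_seq"] by simp
  hence "(\<lambda>n. dist (of_rat (q n)) (x n) +
      dist (of_rat (q n)) (abs_padic (Abs_padic_seq q :: 'a padic_seq))) \<longlonglongrightarrow> 0 + 0"
    using lim unfolding tendsto_dist_iff[of _ "abs_padic _"] by (intro tendsto_add)
  hence "(\<lambda>n. dist (x n) (abs_padic (Abs_padic_seq q :: 'a padic_seq))) \<longlonglongrightarrow> 0"
    by (intro Lim_null_comparison[of "\<lambda>n. dist (x n) (abs_padic (Abs_padic_seq q))"])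
       (auto intro!: always_eventually dist_triangle3)
  hence "x \<longlonglongrightarrow> abs_padic (Abs_padic_seq q :: 'a padic_seq)"
    by (rule iffD2[OF tendsto_dist_iff])
  thus "convergent x" by (auto simp: convergent_def)
qed


section \<open>Manifolds and Lie groups over the reals and over the p-adic numbers\<close>

text \<open>
  Coordinate n-space over K is represented by the functions \<^term>\<open>x :: nat \<Rightarrow> 'k\<close> vanishing
  at all indices \<open>i \<ge> n\<close>, so that \<open>n = 0\<close> is included. Over the reals this is
  \<^const>\<open>Euclidean_space\<close> from the library.
\<close>

definition coord_space :: "nat \<Rightarrow> (nat \<Rightarrow> 'k::{topological_space,zero}) topology" where
  "coord_space n = subtopology (product_topology (\<lambda>_. euclidean) UNIV) {x. \<forall>i\<ge>n. x i = 0}"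

lemma coord_space_real: "coord_space n = Euclidean_space n"
  by (simp add: coord_space_def Euclidean_space_def)

definition coord_append :: "nat \<Rightarrow> (nat \<Rightarrow> 'k) \<Rightarrow> (nat \<Rightarrow> 'k) \<Rightarrow> nat \<Rightarrow> 'k" where
  "coord_append m x y = (\<lambda>i. if i < m then x i else y (i - m))"

text \<open>
  Both kinds of manifold are instances of one definition, whose parameter \<open>reg\<close> says which
  scalar functions on an open set \<open>U\<close> of n-space are admitted: \<open>reg n U f\<close>.
\<close>

type_synonym 'k regularity = "nat \<Rightarrow> (nat \<Rightarrow> 'k) set \<Rightarrow> ((nat \<Rightarrow> 'k) \<Rightarrow> 'k) \<Rightarrow> bool"

type_synonym ('a, 'k) chart = "'a set \<times> ('a \<Rightarrow> nat \<Rightarrow> 'k)"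

primrec Ck_on :: "nat \<Rightarrow> real regularity" where
  "Ck_on 0 n U f \<longleftrightarrow> continuous_map (subtopology (coord_space n) U) euclidean f"
| "Ck_on (Suc k) n U f \<longleftrightarrow> continuous_map (subtopology (coord_space n) U) euclidean f \<and>
     (\<forall>i<n. \<exists>g. Ck_on k n U g \<and>
        (\<forall>x\<in>U. ((\<lambda>t. f (x(i := t))) has_real_derivative g x) (at (x i))))"

definition smooth_on :: "real regularity" where
  "smooth_on n U f \<longleftrightarrow> (\<forall>k. Ck_on k n U f)"

text \<open>
  Locally the sum of a power series in \<open>n\<close> variables; a multi-index \<open>\<alpha>\<close> is a
  function \<^typ>\<open>nat \<Rightarrow> nat\<close> vanishing from \<open>n\<close> on.
\<close>

definition padic_analytic_on :: "'p::prime_card padic regularity" where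
  "padic_analytic_on n U f \<longleftrightarrow>
     (\<forall>a\<in>U. \<exists>c. \<exists>r>0. \<forall>x\<in>topspace (coord_space n). (\<forall>i<n. dist (x i) (a i) < r) \<longrightarrow>
        x \<in> U \<and>
        ((\<lambda>\<alpha>. c \<alpha> * (\<Prod>i<n. (x i - a i) ^ \<alpha> i)) has_sum f x) {\<alpha>. \<forall>i\<ge>n. \<alpha> i = 0})"

definition regular_map ::
    "'k regularity \<Rightarrow> nat \<Rightarrow> nat \<Rightarrow> (nat \<Rightarrow> 'k) set \<Rightarrow> ((nat \<Rightarrow> 'k) \<Rightarrow> nat \<Rightarrow> 'k) \<Rightarrow> bool" where
  "regular_map reg m n U F \<longleftrightarrow> (\<forall>i<n. reg m U (\<lambda>x. F x i))"

definition is_chart ::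
    "nat \<Rightarrow> 'a topology \<Rightarrow> ('a, 'k::{topological_space,zero}) chart \<Rightarrow> bool" where
  "is_chart n T = (\<lambda>(U, \<phi>). openin T U \<and> openin (coord_space n) (\<phi> ` U) \<and>
     homeomorphic_map (subtopology T U) (subtopology (coord_space n) (\<phi> ` U)) \<phi>)"

definition is_atlas ::
    "'k::{topological_space,zero} regularity \<Rightarrow> nat \<Rightarrow> 'a topology \<Rightarrow> ('a, 'k) chart set \<Rightarrow> bool" where
  "is_atlas reg n T A \<longleftrightarrow>
     (\<forall>c\<in>A. is_chart n T c) \<and>
     topspace T = (\<Union>(U, \<phi>)\<in>A. U) \<and>
     (\<forall>(U, \<phi>)\<in>A. \<forall>(V, \<psi>)\<in>A. regular_map reg n n (\<phi> ` (U \<inter> V)) (\<psi> \<circ> inv_into U \<phi>))"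

text \<open>Second countability is not required: it is automatic for compact manifolds.\<close>

definition is_manifold ::
    "'k::{topological_space,zero} regularity \<Rightarrow> nat \<Rightarrow> 'a topology \<Rightarrow> ('a, 'k) chart set \<Rightarrow> bool" where
  "is_manifold reg n T A \<longleftrightarrow> Hausdorff_space T \<and> is_atlas reg n T A"

definition manifold_map ::
    "'k regularity \<Rightarrow> nat \<Rightarrow> 'a topology \<Rightarrow> ('a, 'k) chart set \<Rightarrow>
     nat \<Rightarrow> 'b topology \<Rightarrow> ('b, 'k) chart set \<Rightarrow> ('a \<Rightarrow> 'b) \<Rightarrow> bool" where
  "manifold_map reg m S A n T B f \<longleftrightarrow> continuous_map S T f \<and>
     (\<forall>(U, \<phi>)\<in>A. \<forall>(V, \<psi>)\<in>B.
        regular_map reg m n (\<phi> ` {x\<in>U. f x \<in> V}) (\<psi> \<circ> f \<circ> inv_into U \<phi>))"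

definition product_atlas ::
    "nat \<Rightarrow> ('a, 'k) chart set \<Rightarrow> ('b, 'k) chart set \<Rightarrow> ('a \<times> 'b, 'k) chart set" where
  "product_atlas m A B =
     {(U \<times> V, \<lambda>(x, y). coord_append m (\<phi> x) (\<psi> y)) |U \<phi> V \<psi>. (U, \<phi>) \<in> A \<and> (V, \<psi>) \<in> B}"

definition lie_group ::
    "'k::{topological_space,zero} regularity \<Rightarrow> nat \<Rightarrow> ('a, 'b) monoid_scheme \<Rightarrow>
     'a topology \<Rightarrow> ('a, 'k) chart set \<Rightarrow> bool" where
  "lie_group reg n G T A \<longleftrightarrow>
     group G \<and> topspace T = carrier G \<and> is_manifold reg n T A \<and>
     manifold_map reg (n + n) (prod_topology T T) (product_atlas n A A) n T A
       (\<lambda>(x, y). x \<otimes>\<^bsub>G\<^esub> y) \<and>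
     manifold_map reg n T A n T A (\<lambda>x. inv\<^bsub>G\<^esub> x)"

abbreviation "real_lie_group \<equiv> lie_group smooth_on"

abbreviation "padic_lie_group \<equiv> lie_group padic_analytic_on"


section \<open>Compatible metrics\<close>

definition real_coord_dist :: "nat \<Rightarrow> (nat \<Rightarrow> real) \<Rightarrow> (nat \<Rightarrow> real) \<Rightarrow> real" where
  "real_coord_dist n x y = L2_set (\<lambda>i. x i - y i) {..<n}"

definition padic_coord_dist ::
    "nat \<Rightarrow> (nat \<Rightarrow> 'p::prime_card padic) \<Rightarrow> (nat \<Rightarrow> 'p padic) \<Rightarrow> real" where
  "padic_coord_dist n x y = Max (insert 0 ((\<lambda>i. dist (x i) (y i)) ` {..<n}))"

text \<open>
  The chart \<open>(U, \<phi>)\<close> need not belong to the given atlas \<open>A\<close>; it is any chart of the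
  manifold, that is, adding it to \<open>A\<close> still gives an atlas. That \<open>d\<close> induces the
  topology of \<open>G\<close> is not assumed; for compact \<open>G\<close> it is a consequence.
\<close>

definition compatible_metric ::
    "'k::{topological_space,zero} regularity \<Rightarrow> (nat \<Rightarrow> (nat \<Rightarrow> 'k) \<Rightarrow> (nat \<Rightarrow> 'k) \<Rightarrow> real) \<Rightarrow>
     nat \<Rightarrow> ('a, 'b) monoid_scheme \<Rightarrow> 'a topology \<Rightarrow> ('a, 'k) chart set \<Rightarrow>
     ('a \<Rightarrow> 'a \<Rightarrow> real) \<Rightarrow> bool" where
  "compatible_metric reg \<rho> n G T A d \<longleftrightarrow>
     Metric_space (carrier G) d \<and>
     (\<forall>g\<in>carrier G. \<forall>x\<in>carrier G. \<forall>y\<in>carrier G.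
        d (g \<otimes>\<^bsub>G\<^esub> x) (g \<otimes>\<^bsub>G\<^esub> y) = d x y \<and> d (x \<otimes>\<^bsub>G\<^esub> g) (y \<otimes>\<^bsub>G\<^esub> g) = d x y) \<and>
     (\<exists>U \<phi> V L. is_atlas reg n T (insert (U, \<phi>) A) \<and>
        openin T V \<and> \<one>\<^bsub>G\<^esub> \<in> V \<and> V \<subseteq> U \<and> L > 0 \<and>
        (\<forall>x\<in>V. \<forall>y\<in>V. \<rho> n (\<phi> x) (\<phi> y) \<le> L * d x y \<and> d x y \<le> L * \<rho> n (\<phi> x) (\<phi> y)))"

abbreviation "real_compatible_metric \<equiv> compatible_metric smooth_on real_coord_dist"

abbreviation "padic_compatible_metric \<equiv> compatible_metric padic_analytic_on padic_coord_dist"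


section \<open>Packing numbers and upper Minkowski dimension\<close>

text \<open>
  A family of pairwise disjoint balls is given by the set \<open>C\<close> of its centres. The balls are
  those of the metric space \<open>X\<close>, i.e. of the metric restricted to \<open>X\<close>. The supremum is a
  maximum whenever it is finite.
\<close>

definition packing_number :: "'a set \<Rightarrow> ('a \<Rightarrow> 'a \<Rightarrow> real) \<Rightarrow> real \<Rightarrow> enat" where
  "packing_number X d \<delta> =
     (SUP C\<in>{C. finite C \<and> C \<subseteq> X \<and>
        pairwise (\<lambda>x y. disjnt (Metric_space.mball X d x \<delta>) (Metric_space.mball X d y \<delta>)) C}.
      enat (card C))"

definition ln_enat :: "enat \<Rightarrow> ereal" where
  "ln_enat N = (case N of enat k \<Rightarrow> ereal (ln (real k)) | \<infinity> \<Rightarrow> \<infinity>)"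

definition upper_minkowski_dim :: "'a set \<Rightarrow> ('a \<Rightarrow> 'a \<Rightarrow> real) \<Rightarrow> ereal" where
  "upper_minkowski_dim X d =
     Limsup (at_right 0) (\<lambda>\<delta>. - ln_enat (packing_number X d \<delta>) / ereal (ln \<delta>))"

end

theory Submission
  imports Defs "HOL-Real_Asymp.Real_Asymp"
begin

text \<open>
  Let \<open>N(s)\<close> be the largest size of an \<open>s\<close>-separated set in \<open>G\<close>. A chart that is bi-Lipschitz near
  the identity, together with translation invariance, shows that \<open>N(s)\<close> is of order \<open>s\<^sup>-\<^sup>n\<close>, and that
  a small ball of radius \<open>r\<close> has \<open>s\<close>-nets of at most \<open>C (r / s)\<^sup>n\<close> points
  (\<open>card_separated_coordinates_le\<close>, \<open>exists_separated_coordinates\<close>). The rest of the proof takes place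
  in a compact group with a bi-invariant metric that satisfies these two estimates.

  Every square root has dimension at least \<open>n / 2\<close>: by bi-invariance, if \<open>R\<close> is covered by \<open>k\<close> balls
  of radius \<open>s\<close>, then \<open>R\<^sup>2\<close> is covered by the \<open>k\<^sup>2\<close> balls of radius \<open>2s\<close> around the products of the
  centres, so \<open>k\<^sup>2\<close> is at least of order \<open>s\<^sup>-\<^sup>n\<close> (\<open>card_separated_le_square\<close>).

  For the construction (\<open>exists_thin_square_root\<close>) fix radii \<open>r\<^sub>k\<close> decreasing to 0 and let \<open>S\<^sub>k\<close> be an
  \<open>r\<^sub>k\<^sub>+\<^sub>1\<close>-net of the ball \<open>B\<^sub>k\<close> of radius \<open>r\<^sub>k\<close> around the identity. Balls around the identity are
  invariant under conjugation, so \<open>B\<^sub>k\<close> is contained in \<open>S\<^sub>k B\<^sub>k\<^sub>+\<^sub>1 = B\<^sub>k\<^sub>+\<^sub>1 S\<^sub>k\<close>: an approximation \<open>g = x h y\<close> with an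
  error \<open>h\<close> in \<open>B\<^sub>k\<close> in the middle can be refined by splitting off an element of \<open>S\<^sub>k\<close> on either side
  of \<open>h\<close> and absorbing it into \<open>x\<close> or into \<open>y\<close>. Doing this alternately, the left factors are
  \<open>x = s\<^sub>0 s\<^sub>2 s\<^sub>4 \<dots>\<close> and the right factors are \<open>y = \<dots> s\<^sub>5 s\<^sub>3 s\<^sub>1 f\<close>, where \<open>f\<close> runs through a finite
  net of \<open>G\<close>. This is the analogue of writing a real number as the sum of its binary digits at
  even places and those at odd places. Each of the two sets of limits spends only every other
  scale; their union is \<open>R\<close>.

  Each scale costs a constant factor \<open>C\<close>, and with \<open>r\<^sub>k\<close> decaying geometrically these constants would
  add to the dimension. With \<open>r\<^sub>k = r\<^sub>0 2\<^bsup>-k\<^sup>2\<^esup>\<close> only about the square root of \<open>log (1/s)\<close> scales are above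
  \<open>s\<close>, so the factors \<open>C\<close> are negligible, while consecutive gaps are still so alike
  that even and odd steps carry the same share: the number of balls of radius about \<open>2\<^bsup>-4m\<^sup>2\<^esup>\<close> needed
  for \<open>R\<close> is \<open>2\<^bsup>2nm\<^sup>2 + O(m)\<^esup>\<close>, which is dimension \<open>n / 2\<close> (\<open>log_ratio_tendsto_half\<close>).
\<close>

section \<open>Separated sets and packing numbers\<close>

lemma ex_max_card:
  assumes "P {}" and "\<And>F. P F \<Longrightarrow> card F \<le> N"
  shows "\<exists>F. P F \<and> (\<forall>F'. P F' \<longrightarrow> card F' \<le> card F)"
    by (rule ex_has_greatest_nat[of P "{}" card "Suc N"]) (use assms in \<open>auto simp: less_Suc_eq_le\<close>)

context Metric_space
begin

text \<open>A separated set of maximal size is a net: any point far from it could be added.\<close>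

lemma finite_net_of_separated_bound:
  assumes "B \<subseteq> M" "0 < s"
    and bound: "\<And>F. finite F \<Longrightarrow> F \<subseteq> B \<Longrightarrow> pairwise (\<lambda>x y. s \<le> d x y) F \<Longrightarrow> real (card F) \<le> b"
  obtains F where "finite F" "F \<subseteq> B" "real (card F) \<le> b" "\<forall>x\<in>B. \<exists>y\<in>F. d x y < s"
proof -
  define P where "P F \<longleftrightarrow> finite F \<and> F \<subseteq> B \<and> pairwise (\<lambda>x y. s \<le> d x y) F" for F
  have "P {}" "\<And>F. P F \<Longrightarrow> card F \<le> nat \<lfloor>b\<rfloor>"
    by (simp_all add: P_def le_nat_floor bound)
  from ex_max_card[of P, OF this]
  obtain F where PF: "P F" and max: "\<And>F'. P F' \<Longrightarrow> card F' \<le> card F" by blast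
  note F = PF[unfolded P_def]
  have "\<exists>y\<in>F. d x y < s" if "x \<in> B" for x
  proof (rule ccontr)
    assume far: "\<not> (\<exists>y\<in>F. d x y < s)"
    have "d x x < s" using that assms by auto
    with far have "x \<notin> F" by blast
    moreover have "P (insert x F)"
      using F far that by (auto simp: P_def pairwise_insert commute not_less)
    ultimately show False using F max[of "insert x F"] by simp
  qed
  thus ?thesis using that[of F] F bound[of F] by blast
qed

text \<open>
  The packing number lies between two covering numbers. Two centres of disjoint \<open>\<delta>\<close>-balls cannot
  share a point of \<open>P\<close> at distance less than \<open>\<delta> / 2\<close>, so any such net bounds it from above. The
  centres of a maximal packing form a \<open>2\<delta>\<close>-net, since the \<open>\<delta>\<close>-ball around any further point meets one of
  the chosen balls.
\<close>

lemma packing_number_attained: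
  assumes X: "X \<subseteq> M" and "0 < \<delta>" and P: "finite P" "P \<subseteq> M" "\<forall>x\<in>X. \<exists>p\<in>P. d x p < \<delta> / 2"
  obtains C where "packing_number X d \<delta> = enat (card C)" "finite C" "C \<subseteq> X" "card C \<le> card P"
    "\<forall>x\<in>X. \<exists>c\<in>C. d x c < 2 * \<delta>"
proof -
  have sub: "Metric_space X d" using X by (rule subspace)
  note in_X_ball = Metric_space.in_mball[OF sub]
  let ?B = "\<lambda>x. Metric_space.mball X d x \<delta>"
  let ?D = "\<lambda>x y. disjnt (?B x) (?B y)"
  define A where "A C \<longleftrightarrow> finite C \<and> C \<subseteq> X \<and> pairwise ?D C" for C
  have le: "card C \<le> card P" if "A C" for C
  proof -
    obtain f where f: "\<And>x. x \<in> X \<Longrightarrow> f x \<in> P \<and> d x (f x) < \<delta> / 2"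
      using P(3) by metis
    have C: "C \<subseteq> X" "pairwise ?D C" using that by (auto simp: A_def)
    have "inj_on f C"
    proof (rule inj_onI, rule ccontr)
      fix x y assume xy: "x \<in> C" "y \<in> C" "f x = f y" "x \<noteq> y"
      hence xX: "x \<in> X" "y \<in> X" using C by auto
      hence "d x y \<le> d x (f x) + d (f x) y"
        using triangle f P(2) X by blast
      also have "\<dots> < \<delta>" using f[OF xX(1)] f[OF xX(2)] xy(3) by (simp add: commute)
      finally have "y \<in> ?B x \<inter> ?B y" using xX X \<open>0 < \<delta>\<close> by (auto simp: in_X_ball)
      moreover have "?D x y" using C xy by (auto simp: pairwise_def)
      ultimately show False by (auto simp: disjnt_def)
    qed
    moreover have "f ` C \<subseteq> P" using f C by auto
    ultimately show ?thesis using P(1) by (metis card_image card_mono)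
  qed
  have "A {}" by (simp add: A_def)
  from ex_max_card[of A, OF this le]
  obtain C where AC: "A C" and max: "\<And>C'. A C' \<Longrightarrow> card C' \<le> card C" by blast
  note C = AC[unfolded A_def]
  have "packing_number X d \<delta> = enat (card C)"
    unfolding packing_number_def
    by (rule antisym; (rule SUP_least SUP_upper)) (use C max in \<open>auto simp: A_def\<close>)
  moreover have "\<exists>c\<in>C. d x c < 2 * \<delta>" if "x \<in> X" for x
  proof (cases "x \<in> C")
    case True
    thus ?thesis using that X \<open>0 < \<delta>\<close> by (intro bexI[of _ x]) auto
  next
    case False
    have "\<not> A (insert x C)" using C False max[of "insert x C"] by auto
    hence "\<exists>c\<in>C. \<not> ?D x c" using C that by (auto simp: A_def pairwise_insert disjnt_sym)
    then obtain c z where "c \<in> C" "z \<in> X" "d x z < \<delta>" "d c z < \<delta>" by (auto simp: disjnt_def in_X_ball)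
    moreover have "d x c \<le> d x z + d z c"
      using that \<open>c \<in> C\<close> \<open>z \<in> X\<close> C X by (intro triangle) auto
    ultimately show ?thesis by (intro bexI[of _ c]) (auto simp: commute)
  qed
  ultimately show ?thesis using that[of C] C le[OF AC] by blast
qed

text \<open>
  When the steps at least halve each time, each step is at most twice the drop from it to the
  next, and the tail telescopes to \<open>2 * a m\<close>.
\<close>

lemma fast_sequence_converges:
  assumes mcomplete and x: "\<And>m. x m \<in> M" and step: "\<And>m. d (x m) (x (Suc m)) \<le> a m"
    and a: "\<And>m. 2 * a (Suc m) \<le> a m"
  obtains l where "l \<in> M" "\<And>m. d (x m) l \<le> 2 * a m"
proof -
  have a0: "0 \<le> a m" for m using step[of m] nonneg[of "x m" "x (Suc m)"] by linarith
  have tail: "d (x m) (x (m + k)) \<le> 2 * a m - 2 * a (m + k)" for m k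
  proof (induction k)
    case (Suc k)
    have "d (x m) (x (m + Suc k)) \<le> d (x m) (x (m + k)) + d (x (m + k)) (x (Suc (m + k)))"
      using triangle x by simp
    thus ?case using Suc step[of "m + k"] a[of "m + k"] by simp
  qed (use x in simp)
  hence tail': "d (x m) (x n) \<le> 2 * a m" if "m \<le> n" for m n
    using a0[of n] tail[of m "n - m"] that by simp
  have geo: "a m \<le> a 0 * (1 / 2) ^ m" for m
  proof (induction m)
    case (Suc m)
    thus ?case using a[of m] by simp
  qed simp
  have "(\<lambda>m. 4 * (a 0 * (1 / 2) ^ m)) \<longlonglongrightarrow> 4 * (a 0 * 0)"
    by (intro tendsto_intros LIMSEQ_power_zero) simp
  hence small: "\<exists>m. 4 * a m < e" if "e > 0" for e
    using order_tendstoD(2)[of _ 0 sequentially e] geo that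
    unfolding eventually_sequentially
    by (metis (no_types, lifting) le_less_trans mult_le_cancel_left_pos mult_zero_right order_refl
        zero_less_numeral)
  have "MCauchy x" unfolding MCauchy_def
  proof (intro conjI allI impI)
    show "range x \<subseteq> M" using x by auto
    fix e :: real assume "e > 0"
    then obtain m where m: "4 * a m < e" using small by blast
    show "\<exists>N. \<forall>n n'. N \<le> n \<longrightarrow> N \<le> n' \<longrightarrow> d (x n) (x n') < e"
    proof (intro exI allI impI)
      fix n n' assume "m \<le> n" "m \<le> n'"
      thus "d (x n) (x n') < e"
        using triangle[of "x n" "x m" "x n'"] x tail'[of m n] tail'[of m n'] m
        by (simp add: commute)
    qed
  qed
  then obtain l where l: "limitin mtopology x l sequentially"
    using \<open>mcomplete\<close> unfolding mcomplete_def by blast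
  hence "l \<in> M" by (rule limitin_mspace)
  moreover have "d (x m) l \<le> 2 * a m" for m
  proof (rule field_le_epsilon)
    fix e :: real assume "e > 0"
    then obtain N where N: "\<And>n. n \<ge> N \<Longrightarrow> d (x n) l < e"
      using l by (auto simp: limit_metric_sequentially) meson
    have "d (x m) l \<le> d (x m) (x (max m N)) + d (x (max m N)) l"
      using triangle x \<open>l \<in> M\<close> by simp
    thus "d (x m) l \<le> 2 * a m + e"
      using tail'[of m "max m N"] N[of "max m N"] by simp
  qed
  ultimately show ?thesis by (rule that)
qed

end

section \<open>Thin square roots in groups with a bi-invariant metric\<close>

locale biinvariant_metric_group = group G + Metric_space "carrier G" d
  for G (structure) and d +
  assumes left_invariant: "\<lbrakk>g \<in> carrier G; x \<in> carrier G; y \<in> carrier G\<rbrakk> \<Longrightarrow>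
      d (g \<otimes> x) (g \<otimes> y) = d x y"
    and right_invariant: "\<lbrakk>g \<in> carrier G; x \<in> carrier G; y \<in> carrier G\<rbrakk> \<Longrightarrow>
      d (x \<otimes> g) (y \<otimes> g) = d x y"
begin

text \<open>Bi-invariance makes the product a contraction for the sum metric.\<close>

lemma dist_mult_le:
  assumes "x \<in> carrier G" "y \<in> carrier G" "x' \<in> carrier G" "y' \<in> carrier G"
  shows "d (x \<otimes> y) (x' \<otimes> y') \<le> d x x' + d y y'"
  using triangle[of "x \<otimes> y" "x' \<otimes> y" "x' \<otimes> y'"] assms
  by (simp add: left_invariant right_invariant)

lemma dist_left_quotient:
  assumes "g \<in> carrier G" "h \<in> carrier G"
  shows "d \<one> (inv g \<otimes> h) = d g h"
  using left_invariant[of "inv g" g h] assms by simp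

lemma dist_right_quotient:
  assumes "g \<in> carrier G" "h \<in> carrier G"
  shows "d \<one> (h \<otimes> inv g) = d g h"
  using right_invariant[of "inv g" g h] assms by simp

lemma card_set_mult_le:
  assumes "finite X" "finite Y"
  shows "finite (X <#> Y)" "card (X <#> Y) \<le> card X * card Y"
proof -
  have "X <#> Y = (\<lambda>(x, y). x \<otimes> y) ` (X \<times> Y)" by (auto simp: set_mult_def)
  thus "finite (X <#> Y)" "card (X <#> Y) \<le> card X * card Y"
    using assms card_image_le[of "X \<times> Y" "\<lambda>(x, y). x \<otimes> y"]
    by (simp_all add: card_cartesian_product)
qed

text \<open>
  The lower bound for the dimension: every point of \<open>G\<close> is within \<open>2t\<close> of a product of two elements of
  \<open>C\<close>, and by separation no two points of \<open>F\<close> can use the same product.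
\<close>

lemma card_separated_le_square:
  assumes R: "R \<subseteq> carrier G" "R <#> R = carrier G"
    and C: "finite C" "C \<subseteq> carrier G" "\<forall>x\<in>R. \<exists>c\<in>C. d x c < t"
    and F: "F \<subseteq> carrier G" "pairwise (\<lambda>x y. 4 * t \<le> d x y) F"
  shows "card F \<le> card C ^ 2"
proof -
  have "\<exists>u. fst u \<in> C \<and> snd u \<in> C \<and> d g (fst u \<otimes> snd u) < 2 * t" if "g \<in> F" for g
  proof -
    have "g \<in> R <#> R" using R F that by auto
    then obtain x y where xy: "x \<in> R" "y \<in> R" "g = x \<otimes> y" by (auto simp: set_mult_def)
    then obtain c c' where c: "c \<in> C" "c' \<in> C" "d x c < t" "d y c' < t" using C(3) by blast
    have "d g (c \<otimes> c') \<le> d x c + d y c'"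
      using dist_mult_le[of x y c c'] xy c R C by auto
    thus ?thesis using c by (intro exI[of _ "(c, c')"]) auto
  qed
  then obtain u where u: "\<And>g. g \<in> F \<Longrightarrow> fst (u g) \<in> C \<and> snd (u g) \<in> C \<and>
      d g (fst (u g) \<otimes> snd (u g)) < 2 * t" by metis
  have "inj_on u F"
  proof (rule inj_onI, rule ccontr)
    fix g h assume gh: "g \<in> F" "h \<in> F" "u g = u h" "g \<noteq> h"
    let ?c = "fst (u g) \<otimes> snd (u g)"
    have "d g h \<le> d g ?c + d ?c h"
      using u[OF gh(1)] gh C(2) F(1) by (intro triangle) auto
    also have "\<dots> < 4 * t" using u[OF gh(1)] u[OF gh(2)] gh(3) by (simp add: commute)
    finally show False using F(2) gh by (force simp: pairwise_def)
  qed
  moreover have "u ` F \<subseteq> C \<times> C" unfolding image_subset_iff mem_Times_iff using u by blast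
  ultimately show ?thesis
    using C(1) card_inj_on_le[of u F "C \<times> C"]
    by (simp add: card_cartesian_product power2_eq_square)
qed

text \<open>
  Here \<open>P m\<close> and \<open>Q m\<close> are the sets of partial products on the left and on the right after \<open>m\<close> double
  steps, and \<open>R\<close> consists of the points that stay within the tail bound \<open>2 * \<rho> (2 * m)\<close> of \<open>P m\<close> for
  all \<open>m\<close>, or of \<open>Q m\<close> for all \<open>m\<close>. With this definition the covering bound is immediate, and it
  contains the limits of the partial products of every \<open>g\<close>.
\<close>

theorem exists_thin_square_root:
  fixes n :: nat and C r0 :: real
  assumes complete: mcomplete and tb: "mtotally_bounded (carrier G)"
    and "0 < r0" "1 \<le> C"
    and packing: "\<And>r s F. \<lbrakk>0 < s; s \<le> r; r \<le> r0; finite F; F \<subseteq> mball \<one> r;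
       pairwise (\<lambda>x y. s \<le> d x y) F\<rbrakk> \<Longrightarrow> real (card F) \<le> C * (r / s) ^ n"
  obtains R K where "R \<subseteq> carrier G" "R <#> R = carrier G" "1 \<le> K"
    "\<forall>m. \<exists>P. finite P \<and> P \<subseteq> carrier G \<and> real (card P) \<le> K ^ (m + 1) * 2 ^ (2 * n * m\<^sup>2) \<and>
       (\<forall>x\<in>R. \<exists>p\<in>P. d x p \<le> 2 * (r0 / 2 ^ (4 * m\<^sup>2)))"
proof -
  define \<rho> where "\<rho> k = r0 / 2 ^ (k\<^sup>2)" for k :: nat
  have \<rho>_pos: "0 < \<rho> k" for k using \<open>0 < r0\<close> by (simp add: \<rho>_def)
  have \<rho>_step: "\<rho> k = 2 ^ (2 * k + 1) * \<rho> (Suc k)" for k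
  proof -
    have "(2::real) ^ ((Suc k)\<^sup>2) = 2 ^ (2 * k + 1) * 2 ^ (k\<^sup>2)"
      unfolding power_add[symmetric] by (simp add: power2_eq_square)
    thus ?thesis by (simp add: \<rho>_def)
  qed
  have \<rho>_dec: "2 * \<rho> (Suc k) \<le> \<rho> k" for k
  proof -
    have "(2::real) ^ 1 \<le> 2 ^ (2 * k + 1)" by (rule power_increasing) auto
    hence "2 * \<rho> (Suc k) \<le> 2 ^ (2 * k + 1) * \<rho> (Suc k)"
      using \<rho>_pos[of "Suc k"] by (intro mult_right_mono) simp_all
    thus ?thesis by (simp only: \<rho>_step[of k])
  qed
  have \<rho>_le_Suc: "\<rho> (Suc k) \<le> \<rho> k" for k using \<rho>_dec[of k] \<rho>_pos[of "Suc k"] by linarith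
  have \<rho>_le: "\<rho> k \<le> r0" for k
    using \<open>0 < r0\<close> by (simp add: \<rho>_def divide_le_eq)
  define net where "net k S \<longleftrightarrow> finite S \<and> S \<subseteq> mball \<one> (\<rho> k) \<and>
      real (card S) \<le> C * 2 ^ (n * (2 * k + 1)) \<and> (\<forall>x\<in>mball \<one> (\<rho> k). \<exists>y\<in>S. d x y < \<rho> (Suc k))" for k S
  have "\<exists>S. net k S" for k
  proof (rule finite_net_of_separated_bound[of "mball \<one> (\<rho> k)" "\<rho> (Suc k)" "C * 2 ^ (n * (2 * k + 1))"])
    fix F assume F: "finite F" "F \<subseteq> mball \<one> (\<rho> k)" "pairwise (\<lambda>x y. \<rho> (Suc k) \<le> d x y) F"
    have "real (card F) \<le> C * (\<rho> k / \<rho> (Suc k)) ^ n"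
      by (rule packing[OF \<rho>_pos \<rho>_le_Suc \<rho>_le F])
    also have "\<rho> k / \<rho> (Suc k) = 2 ^ (2 * k + 1)"
      using \<rho>_step[of k] \<rho>_pos[of "Suc k"] by (simp add: field_simps)
    finally show "real (card F) \<le> C * 2 ^ (n * (2 * k + 1))"
      by (simp only: power_mult[symmetric] mult.commute[of "2 * k + 1" n])
  next
    show "mball \<one> (\<rho> k) \<subseteq> carrier G" by auto
  next
    fix S assume "finite S" "S \<subseteq> mball \<one> (\<rho> k)" "real (card S) \<le> C * 2 ^ (n * (2 * k + 1))"
      "\<forall>x\<in>mball \<one> (\<rho> k). \<exists>y\<in>S. d x y < \<rho> (Suc k)"
    thus "\<exists>S. net k S" unfolding net_def by (intro exI[of _ S] conjI)
  qed (rule \<rho>_pos)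
  then obtain S where net: "\<And>k. net k (S k)" by metis
  have S: "\<And>k. finite (S k)" "\<And>k. S k \<subseteq> mball \<one> (\<rho> k)"
      "\<And>k. real (card (S k)) \<le> C * 2 ^ (n * (2 * k + 1))"
      "\<And>k x. x \<in> mball \<one> (\<rho> k) \<Longrightarrow> \<exists>y\<in>S k. d x y < \<rho> (Suc k)"
    using net by (simp_all add: net_def)
  have S_carrier: "S k \<subseteq> carrier G" for k using S(2)[of k] by auto
  from tb[unfolded mtotally_bounded_def, rule_format, OF \<open>0 < r0\<close>]
  obtain F where F: "finite F" "F \<subseteq> carrier G" "carrier G \<subseteq> (\<Union>x\<in>F. mball x r0)"
    by (elim exE conjE) (rule that)
  define P where "P = rec_nat {\<one>} (\<lambda>m X. X <#> S (2 * m))"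
  define Q where "Q = rec_nat F (\<lambda>m Y. S (Suc (2 * m)) <#> Y)"
  have P_simps: "P 0 = {\<one>}" "P (Suc m) = P m <#> S (2 * m)" for m by (simp_all add: P_def)
  have Q_simps: "Q 0 = F" "Q (Suc m) = S (Suc (2 * m)) <#> Q m" for m by (simp_all add: Q_def)
  have P_carrier: "finite (P m) \<and> P m \<subseteq> carrier G" for m
    by (induction m) (use S(1) S_carrier in \<open>simp_all add: P_simps card_set_mult_le set_mult_closed\<close>)
  have Q_carrier: "finite (Q m) \<and> Q m \<subseteq> carrier G" for m
    by (induction m) (use F S(1) S_carrier in \<open>simp_all add: Q_simps card_set_mult_le set_mult_closed\<close>)
  \<comment> \<open>The gaps at the even steps are \<open>4j + 1\<close> binary digits wide, those at the odd steps \<open>4j + 3\<close>; both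
    sum to \<open>2m\<^sup>2 + O(m)\<close>, half of the \<open>4m\<^sup>2\<close> digits of \<open>\<rho> (2 * m)\<close>.\<close>
  have card_P: "real (card (P m)) \<le> C ^ m * 2 ^ (2 * n * m\<^sup>2)" for m
  proof (induction m)
    case (Suc m)
    have "real (card (P (Suc m))) \<le> real (card (P m)) * real (card (S (2 * m)))"
      using card_set_mult_le(2)[of "P m" "S (2 * m)"] P_carrier[of m] S(1)
      by (simp add: P_simps flip: of_nat_mult)
    also have "\<dots> \<le> (C ^ m * 2 ^ (2 * n * m\<^sup>2)) * (C * 2 ^ (n * (2 * (2 * m) + 1)))"
      using Suc S(3)[of "2 * m"] \<open>1 \<le> C\<close> by (intro mult_mono) auto
    also have "\<dots> = C ^ Suc m * 2 ^ (2 * n * m\<^sup>2 + n * (2 * (2 * m) + 1))"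
      by (simp add: power_add)
    also have "\<dots> \<le> C ^ Suc m * 2 ^ (2 * n * (Suc m)\<^sup>2)"
      using \<open>1 \<le> C\<close> by (intro mult_left_mono power_increasing) (auto simp: power2_eq_square algebra_simps)
    finally show ?case .
  qed (simp add: P_simps)
  have card_Q: "real (card (Q m)) \<le> real (card F) * (C ^ m * 2 ^ (n * (2 * m\<^sup>2 + m)))" for m
  proof (induction m)
    case (Suc m)
    have "real (card (Q (Suc m))) \<le> real (card (Q m)) * real (card (S (Suc (2 * m))))"
      using card_set_mult_le(2)[of "S (Suc (2 * m))" "Q m"] Q_carrier[of m] S(1)
      by (simp add: Q_simps mult.commute flip: of_nat_mult)
    also have "\<dots> \<le> (real (card F) * (C ^ m * 2 ^ (n * (2 * m\<^sup>2 + m)))) * (C * 2 ^ (n * (2 * Suc (2 * m) + 1)))"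
      using Suc S(3)[of "Suc (2 * m)"] \<open>1 \<le> C\<close> by (intro mult_mono) auto
    also have "\<dots> = real (card F) * (C ^ Suc m * 2 ^ (n * (2 * m\<^sup>2 + m) + n * (2 * Suc (2 * m) + 1)))"
      by (simp add: power_add)
    also have "n * (2 * m\<^sup>2 + m) + n * (2 * Suc (2 * m) + 1) = n * (2 * (Suc m)\<^sup>2 + Suc m)"
      by (simp add: power2_eq_square algebra_simps)
    finally show ?case .
  qed (simp add: Q_simps)
  define near where "near E = {x \<in> carrier G. \<forall>m. \<exists>p\<in>E m. d x p \<le> 2 * \<rho> (2 * m)}"
    for E :: "nat \<Rightarrow> 'a set"
  define R where "R = near P \<union> near Q"
  define K where "K = (1 + real (card F)) * (C * 2 ^ n)"
  have R_carrier: "R \<subseteq> carrier G" by (auto simp: R_def near_def)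
  have C2: "1 \<le> C * 2 ^ n" using \<open>1 \<le> C\<close> mult_mono[of 1 C 1 "2 ^ n"] by simp
  have K1: "1 \<le> K" unfolding K_def using C2 mult_mono[of 1 "1 + real (card F)" 1 "C * 2 ^ n"] by simp
  have cover: "\<exists>E. finite E \<and> E \<subseteq> carrier G \<and> real (card E) \<le> K ^ (m + 1) * 2 ^ (2 * n * m\<^sup>2) \<and>
       (\<forall>x\<in>R. \<exists>p\<in>E. d x p \<le> 2 * (r0 / 2 ^ (4 * m\<^sup>2)))" for m
  proof (intro exI[of _ "P m \<union> Q m"] conjI)
    show "finite (P m \<union> Q m)" "P m \<union> Q m \<subseteq> carrier G" using P_carrier Q_carrier by auto
    show "\<forall>x\<in>R. \<exists>p\<in>P m \<union> Q m. d x p \<le> 2 * (r0 / 2 ^ (4 * m\<^sup>2))"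
      by (fastforce simp: R_def near_def \<rho>_def power_mult_distrib)
    let ?E = "C ^ m * 2 ^ (n * (2 * m\<^sup>2 + m))"
    have exponent: "n * (2 * m\<^sup>2 + m) = n * m + 2 * n * m\<^sup>2"
      by (simp only: distrib_left mult.left_commute[of n 2] mult.assoc add.commute)
    have E_eq: "?E = (C * 2 ^ n) ^ m * 2 ^ (2 * n * m\<^sup>2)"
      unfolding exponent power_add power_mult_distrib power_mult[of 2 n m, symmetric] by simp
    have P_le: "C ^ m * 2 ^ (2 * n * m\<^sup>2) \<le> ?E"
      unfolding exponent using \<open>1 \<le> C\<close> by (intro mult_left_mono power_increasing) auto
    have "real (card (P m \<union> Q m)) \<le> real (card (P m)) + real (card (Q m))"
      using card_Un_le[of "P m" "Q m"] by (simp flip: of_nat_add)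
    also have "\<dots> \<le> ?E + real (card F) * ?E"
      using card_P[of m] card_Q[of m] P_le by linarith
    also have "\<dots> = (1 + real (card F)) * (C * 2 ^ n) ^ m * 2 ^ (2 * n * m\<^sup>2)"
      unfolding E_eq by (simp add: distrib_right)
    also have "\<dots> \<le> K ^ (m + 1) * 2 ^ (2 * n * m\<^sup>2)"
    proof (rule mult_right_mono)
      have "1 + real (card F) \<le> (1 + real (card F)) ^ (m + 1)"
        by (rule self_le_power) simp_all
      moreover have "(C * 2 ^ n) ^ m \<le> (C * 2 ^ n) ^ (m + 1)"
        by (rule power_increasing[OF _ C2]) simp
      ultimately have "(1 + real (card F)) * (C * 2 ^ n) ^ m
          \<le> (1 + real (card F)) ^ (m + 1) * (C * 2 ^ n) ^ (m + 1)"
        using C2 by (intro mult_mono) auto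
      thus "(1 + real (card F)) * (C * 2 ^ n) ^ m \<le> K ^ (m + 1)"
        by (simp only: K_def power_mult_distrib)
    qed simp
    finally show "real (card (P m \<union> Q m)) \<le> K ^ (m + 1) * 2 ^ (2 * n * m\<^sup>2)" .
  qed
  have factor: "g \<in> R <#> R" if g: "g \<in> carrier G" for g
  proof -
    \<comment> \<open>A state \<open>(x, h, y)\<close> is an approximate factorisation of \<open>g\<close> with the error \<open>h\<close> in the middle.\<close>
    define I where "I m = (\<lambda>(x, h, y). x \<in> P m \<and> y \<in> Q m \<and> h \<in> mball \<one> (\<rho> (2 * m)) \<and> g = x \<otimes> h \<otimes> y)" for m
    define J where "J m = (\<lambda>(x, h :: 'a, y) (x', h' :: 'a, y'). d x x' \<le> \<rho> (2 * m) \<and> d y y' \<le> \<rho> (2 * m))" for m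
    have base: "\<exists>w. I 0 w"
    proof -
      obtain f where f: "f \<in> F" "d f g < r0" using F(3) g by auto
      hence fc: "f \<in> carrier G" using F by auto
      hence "I 0 (\<one>, g \<otimes> inv f, f)"
        using g f by (simp add: I_def P_simps Q_simps \<rho>_def dist_right_quotient m_assoc)
      thus ?thesis by blast
    qed
    have step: "\<exists>w'. I (Suc m) w' \<and> J m w w'" if "I m w" for m w
    proof -
      obtain x h y where w_eq: "w = (x, h, y)" by (cases w)
      have x: "x \<in> P m" and y: "y \<in> Q m" and hB: "h \<in> mball \<one> (\<rho> (2 * m))"
        and g_eq: "g = x \<otimes> h \<otimes> y"
        using that by (simp_all only: w_eq I_def prod.case)
      have h: "h \<in> carrier G" using hB by simp
      have xy: "x \<in> carrier G" "y \<in> carrier G" using x y P_carrier Q_carrier by blast+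
      obtain s where s: "s \<in> S (2 * m)" "d h s < \<rho> (Suc (2 * m))" using S(4)[OF hB] by blast
      have sc: "s \<in> carrier G" "d \<one> s < \<rho> (2 * m)" using s S(2)[of "2 * m"] by auto
      \<comment> \<open>Split an element of the net off \<open>h\<close> on the left, then one on the right.\<close>
      define h1 where "h1 = inv s \<otimes> h"
      have h1: "h1 \<in> mball \<one> (\<rho> (Suc (2 * m)))"
        using s sc h by (simp add: h1_def dist_left_quotient commute)
      obtain t where t: "t \<in> S (Suc (2 * m))" "d h1 t < \<rho> (Suc (Suc (2 * m)))"
        using S(4)[OF h1] by blast
      have tc: "t \<in> carrier G" "d \<one> t < \<rho> (Suc (2 * m))" using t S(2)[of "Suc (2 * m)"] by auto
      define h2 where "h2 = h1 \<otimes> inv t"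
      have h1c: "h1 \<in> carrier G" using h1 by simp
      have "h2 \<in> mball \<one> (\<rho> (2 * Suc m))"
        using t tc h1 by (simp add: h2_def dist_right_quotient commute)
      moreover have "x \<otimes> s \<in> P (Suc m)" "t \<otimes> y \<in> Q (Suc m)"
        using x y s t by (auto simp: P_simps Q_simps set_mult_def)
      moreover have "g = (x \<otimes> s) \<otimes> h2 \<otimes> (t \<otimes> y)"
      proof -
        have "(x \<otimes> s) \<otimes> h2 \<otimes> (t \<otimes> y) = x \<otimes> (s \<otimes> (h1 \<otimes> (inv t \<otimes> (t \<otimes> y))))"
          using xy sc tc h1c by (simp add: h2_def m_assoc)
        also have "\<dots> = x \<otimes> (s \<otimes> (h1 \<otimes> y))"
          using xy tc by (simp flip: m_assoc)
        also have "s \<otimes> (h1 \<otimes> y) = h \<otimes> y"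
          using xy sc h by (simp add: h1_def flip: m_assoc)
        also have "x \<otimes> (h \<otimes> y) = g" using xy h g_eq by (simp add: m_assoc)
        finally show ?thesis by simp
      qed
      moreover have "d x (x \<otimes> s) \<le> \<rho> (2 * m)"
        using left_invariant[of x \<one> s] xy sc by simp
      moreover have "d y (t \<otimes> y) \<le> \<rho> (2 * m)"
        using right_invariant[of y \<one> t] xy tc \<rho>_dec[of "2 * m"] \<rho>_pos[of "Suc (2 * m)"] by simp
      ultimately show ?thesis by (intro exI[of _ "(x \<otimes> s, h2, t \<otimes> y)"]) (simp add: I_def J_def w_eq)
    qed
    obtain w where w: "\<And>m. I m (w m)" "\<And>m. J m (w m) (w (Suc m))"
      using dependent_nat_choice[of I J, OF base step] by blast
    define x h y where "x m = fst (w m)" and "h m = fst (snd (w m))" and "y m = snd (snd (w m))" for m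
    have w_eq: "w m = (x m, h m, y m)" for m by (simp add: x_def y_def h_def)
    have xP: "x m \<in> P m" and yQ: "y m \<in> Q m" and hB: "h m \<in> mball \<one> (\<rho> (2 * m))"
      and g_eq: "g = x m \<otimes> h m \<otimes> y m" for m using w(1)[of m] by (auto simp: w_eq I_def)
    have xc: "x m \<in> carrier G" and yc: "y m \<in> carrier G" and hc: "h m \<in> carrier G" for m
      using xP yQ hB P_carrier[of m] Q_carrier[of m] by (auto simp del: in_mball simp: mball_def) 
    have dec2: "2 * \<rho> (2 * Suc m) \<le> \<rho> (2 * m)" for m
      using \<rho>_dec[of "2 * m"] \<rho>_dec[of "Suc (2 * m)"] \<rho>_pos[of "2 * Suc m"] by simp
    obtain a where a: "a \<in> carrier G" "\<And>m. d (x m) a \<le> 2 * \<rho> (2 * m)"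
      by (rule fast_sequence_converges[OF complete, of x "\<lambda>m. \<rho> (2 * m)"])
         (use xc w(2) dec2 in \<open>auto simp: w_eq J_def\<close>)
    obtain b where b: "b \<in> carrier G" "\<And>m. d (y m) b \<le> 2 * \<rho> (2 * m)"
      by (rule fast_sequence_converges[OF complete, of y "\<lambda>m. \<rho> (2 * m)"])
         (use yc w(2) dec2 in \<open>auto simp: w_eq J_def\<close>)
    have "a \<in> near P" using a xP commute unfolding near_def by force
    moreover have "b \<in> near Q" using b yQ commute unfolding near_def by force
    moreover have "g = a \<otimes> b"
    proof -
      have "d g (a \<otimes> b) \<le> 5 * \<rho> (2 * m)" for m
      proof -
        have "d g (a \<otimes> b) \<le> d (x m \<otimes> h m) a + d (y m) b"
          unfolding g_eq[of m] using xc yc hc a b by (intro dist_mult_le) auto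
        also have "d (x m \<otimes> h m) a \<le> d (x m) a + d (h m) \<one>"
          using dist_mult_le[of "x m" "h m" a \<one>] xc hc a by simp
        finally show ?thesis using a(2)[of m] b(2)[of m] hB[of m] by (simp add: commute)
      qed
      moreover have "(\<lambda>m. 5 * \<rho> (2 * m)) \<longlonglongrightarrow> 0" unfolding \<rho>_def by real_asymp
      ultimately have "d g (a \<otimes> b) \<le> 0" by (intro LIMSEQ_le_const[of _ 0]) blast+
      thus ?thesis using g a b nonneg[of g "a \<otimes> b"] by simp
    qed
    ultimately show ?thesis by (auto simp: R_def set_mult_def)
  qed
  have "R <#> R = carrier G"
    using factor set_mult_closed[OF R_carrier R_carrier] by blast
  from that[OF R_carrier this K1 allI, OF cover] show ?thesis .
qed

end

section \<open>From covering numbers to the Minkowski dimension\<close>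

text \<open>
  For given \<open>\<delta>\<close> the bound \<open>upper\<close> is used with the least admissible \<open>m\<close>, which is about \<open>q \<delta>\<close>, the
  solution of \<open>4 * r0 / 2 powr (4 * q\<^sup>2) = \<delta>\<close>. Then \<open>m * ln K\<close> grows only like the square root of
  \<open>- ln \<delta>\<close>, and \<open>2 * n * m\<^sup>2 * ln 2\<close> like \<open>(n / 2) * (- ln \<delta>)\<close>.
\<close>

lemma log_ratio_tendsto_half:
  fixes N :: "real \<Rightarrow> nat" and n :: nat and c K r0 \<delta>0 :: real
  assumes "0 < c" "1 \<le> K" "0 < r0" "0 < \<delta>0"
    and lower: "\<And>\<delta>. 0 < \<delta> \<Longrightarrow> \<delta> < \<delta>0 \<Longrightarrow> c / \<delta> ^ n \<le> (real (N \<delta>))\<^sup>2"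
    and upper: "\<And>\<delta> m. 0 < \<delta> \<Longrightarrow> 4 * r0 / 2 ^ (4 * m\<^sup>2) < \<delta> \<Longrightarrow>
      real (N \<delta>) \<le> K ^ (m + 1) * 2 ^ (2 * n * m\<^sup>2)"
  shows "((\<lambda>\<delta>. - ln (real (N \<delta>)) / ln \<delta>) \<longlongrightarrow> real n / 2) (at_right 0)"
proof (rule tendsto_sandwich)
  define q where "q \<delta> = sqrt ((ln (4 * r0) - ln \<delta>) / (4 * ln 2))" for \<delta> :: real
  let ?lo = "\<lambda>\<delta>::real. (ln c - real n * ln \<delta>) / 2 / (- ln \<delta>)"
  let ?up = "\<lambda>\<delta>::real. ((q \<delta> + 2) * ln K + 2 * real n * (q \<delta> + 1)\<^sup>2 * ln 2) / (- ln \<delta>)"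
  have "((\<lambda>\<delta>::real. 1 / ln \<delta>) \<longlongrightarrow> 0) (at_right 0)" by real_asymp
  hence "((\<lambda>\<delta>::real. real n / 2 - ln c / 2 * (1 / ln \<delta>)) \<longlongrightarrow> real n / 2 - ln c / 2 * 0) (at_right 0)"
    by (intro tendsto_intros)
  moreover have near: "eventually (\<lambda>\<delta>::real. 0 < \<delta> \<and> \<delta> < min (min 1 \<delta>0) (4 * r0)) (at_right 0)"
    using eventually_at_right_real[of 0 "min (min 1 \<delta>0) (4 * r0)"] assms by simp
  hence "eventually (\<lambda>\<delta>::real. real n / 2 - ln c / 2 * (1 / ln \<delta>) = ?lo \<delta>) (at_right 0)"
    by eventually_elim (simp add: field_simps)
  ultimately show "(?lo \<longlongrightarrow> real n / 2) (at_right 0)"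
    by (simp add: filterlim_cong)
  have q1: "((\<lambda>\<delta>. q \<delta> / (- ln \<delta>)) \<longlongrightarrow> 0) (at_right 0)"
    unfolding q_def by real_asymp
  have "((\<lambda>\<delta>. (ln (4 * r0) - ln \<delta>) / (4 * ln 2) / (- ln \<delta>)) \<longlongrightarrow> inverse (ln 2) / 4) (at_right 0)"
    by real_asymp
  moreover have "eventually (\<lambda>\<delta>. (ln (4 * r0) - ln \<delta>) / (4 * ln 2) / (- ln \<delta>) = (q \<delta>)\<^sup>2 / (- ln \<delta>)) (at_right 0)"
    using near
  proof eventually_elim
    case (elim \<delta>)
    hence "ln \<delta> \<le> ln (4 * r0)" by simp
    thus ?case by (simp add: q_def)
  qed
  ultimately have q2: "((\<lambda>\<delta>. (q \<delta>)\<^sup>2 / (- ln \<delta>)) \<longlongrightarrow> inverse (ln 2) / 4) (at_right 0)"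
    by (rule Lim_transform_eventually)
  have l0: "((\<lambda>\<delta>::real. 1 / (- ln \<delta>)) \<longlongrightarrow> 0) (at_right 0)" by real_asymp
  have "((\<lambda>\<delta>. (q \<delta> / (- ln \<delta>) + 2 * (1 / (- ln \<delta>))) * ln K +
      2 * real n * ((q \<delta>)\<^sup>2 / (- ln \<delta>) + 2 * (q \<delta> / (- ln \<delta>)) + 1 / (- ln \<delta>)) * ln 2)
     \<longlongrightarrow> (0 + 2 * 0) * ln K + 2 * real n * (inverse (ln 2) / 4 + 2 * 0 + 0) * ln 2) (at_right 0)"
    by (intro tendsto_intros q1 q2 l0)
  moreover have "eventually (\<lambda>\<delta>. (q \<delta> / (- ln \<delta>) + 2 * (1 / (- ln \<delta>))) * ln K +
      2 * real n * ((q \<delta>)\<^sup>2 / (- ln \<delta>) + 2 * (q \<delta> / (- ln \<delta>)) + 1 / (- ln \<delta>)) * ln 2 = ?up \<delta>) (at_right 0)"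
    using near
  proof eventually_elim
    case (elim \<delta>)
    hence "ln \<delta> < 0" by simp
    thus ?case by (simp add: field_simps power2_eq_square)
  qed
  ultimately have "(?up \<longlongrightarrow> (0 + 2 * 0) * ln K + 2 * real n * (inverse (ln 2) / 4 + 2 * 0 + 0) * ln 2)
      (at_right 0)"
    by (rule Lim_transform_eventually)
  moreover have "(0 + 2 * 0) * ln K + 2 * real n * (inverse (ln 2) / 4 + 2 * 0 + 0) * ln 2 = real n / 2"
    by (simp add: field_simps)
  ultimately show "(?up \<longlongrightarrow> real n / 2) (at_right 0)"
    by (simp only:)
  show "eventually (\<lambda>\<delta>. ?lo \<delta> \<le> - ln (real (N \<delta>)) / ln \<delta>) (at_right 0)"
    using near
  proof eventually_elim
    case (elim \<delta>)
    hence neg: "ln \<delta> < 0" by simp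
    have "0 < c / \<delta> ^ n" using elim assms by simp
    also have le: "c / \<delta> ^ n \<le> (real (N \<delta>))\<^sup>2" by (rule lower) (use elim in auto)
    finally have pos: "0 < real (N \<delta>)" by simp
    have "ln c - real n * ln \<delta> = ln (c / \<delta> ^ n)"
      using elim assms by (simp add: ln_div ln_realpow)
    also have "\<dots> \<le> ln ((real (N \<delta>))\<^sup>2)" using le elim assms pos by simp
    also have "\<dots> = 2 * ln (real (N \<delta>))" using pos by (simp add: ln_realpow)
    finally show ?case using neg by (simp add: field_simps)
  qed
  show "eventually (\<lambda>\<delta>. - ln (real (N \<delta>)) / ln \<delta> \<le> ?up \<delta>) (at_right 0)"
    using near
  proof eventually_elim
    case (elim \<delta>)
    hence neg: "ln \<delta> < 0" and \<delta>: "0 < \<delta>" "\<delta> < \<delta>0" "ln \<delta> \<le> ln (4 * r0)" by simp_all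
    have "0 < c / \<delta> ^ n" using \<delta> assms by simp
    also have "\<dots> \<le> (real (N \<delta>))\<^sup>2" by (rule lower) (use \<delta> in auto)
    finally have pos: "0 < real (N \<delta>)" by simp
    have q: "0 \<le> q \<delta>" "(q \<delta>)\<^sup>2 * (4 * ln 2) = ln (4 * r0) - ln \<delta>" using \<delta> by (simp_all add: q_def)
    define m where "m = nat \<lfloor>q \<delta>\<rfloor> + 1"
    have m: "q \<delta> < real m" "real m \<le> q \<delta> + 1" using q(1) unfolding m_def by linarith+
    have "(q \<delta>)\<^sup>2 < (real m)\<^sup>2" using q(1) m(1) by (simp add: power_strict_mono)
    hence "ln (4 * r0) - ln \<delta> < real (4 * m\<^sup>2) * ln 2" unfolding q(2)[symmetric] by simp
    hence "ln (4 * r0 / \<delta>) < ln (2 ^ (4 * m\<^sup>2))"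
      using \<delta> \<open>0 < r0\<close> by (simp add: ln_div ln_realpow)
    hence "4 * r0 / \<delta> < 2 ^ (4 * m\<^sup>2)" using \<delta> \<open>0 < r0\<close> by (subst (asm) ln_less_cancel_iff) auto
    hence "4 * r0 / 2 ^ (4 * m\<^sup>2) < \<delta>" using \<delta> by (simp add: field_simps)
    hence "real (N \<delta>) \<le> K ^ (m + 1) * 2 ^ (2 * n * m\<^sup>2)" by (intro upper \<delta>)
    hence "ln (real (N \<delta>)) \<le> ln (K ^ (m + 1) * 2 ^ (2 * n * m\<^sup>2))"
      using pos \<open>1 \<le> K\<close> by (subst ln_le_cancel_iff) auto
    also have "\<dots> = (real m + 1) * ln K + 2 * real n * (real m)\<^sup>2 * ln 2"
      using \<open>1 \<le> K\<close> by (simp add: ln_mult ln_realpow algebra_simps)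
    also have "\<dots> \<le> (q \<delta> + 2) * ln K + 2 * real n * (q \<delta> + 1)\<^sup>2 * ln 2"
    proof (rule add_mono)
      show "(real m + 1) * ln K \<le> (q \<delta> + 2) * ln K"
        using m(2) \<open>1 \<le> K\<close> by (intro mult_right_mono) auto
      have "(real m)\<^sup>2 \<le> (q \<delta> + 1)\<^sup>2" using m(2) by (intro power_mono) auto
      thus "2 * real n * (real m)\<^sup>2 * ln 2 \<le> 2 * real n * (q \<delta> + 1)\<^sup>2 * ln 2"
        by (intro mult_right_mono mult_left_mono) auto
    qed
    finally have "ln (real (N \<delta>)) / (- ln \<delta>) \<le> ?up \<delta>"
      using neg by (intro divide_right_mono) auto
    thus ?case by simp
  qed
qed

lemma upper_minkowski_dim_eqI:
  fixes N :: "real \<Rightarrow> nat"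
  assumes "\<And>\<delta>. 0 < \<delta> \<Longrightarrow> packing_number X d \<delta> = enat (N \<delta>)"
    and "((\<lambda>\<delta>. - ln (real (N \<delta>)) / ln \<delta>) \<longlongrightarrow> L) (at_right 0)"
  shows "upper_minkowski_dim X d = ereal L"
  unfolding upper_minkowski_dim_def
proof (rule lim_imp_Limsup)
  have "eventually (\<lambda>\<delta>::real. 0 < \<delta> \<and> \<delta> < 1) (at_right 0)"
    using eventually_at_right_real[of 0 "1::real"] by simp
  hence "eventually (\<lambda>\<delta>. ereal (- ln (real (N \<delta>)) / ln \<delta>) =
      - ln_enat (packing_number X d \<delta>) / ereal (ln \<delta>)) (at_right 0)"
    by eventually_elim (simp add: assms(1) ln_enat_def)
  thus "((\<lambda>\<delta>. - ln_enat (packing_number X d \<delta>) / ereal (ln \<delta>)) \<longlongrightarrow> ereal L) (at_right 0)"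
    using tendsto_ereal[OF assms(2)] by (rule Lim_transform_eventually[rotated])
qed simp

theorem (in biinvariant_metric_group) exists_square_root_of_half_dimension:
  fixes n :: nat and C c r0 s0 :: real
  assumes complete: mcomplete and tb: "mtotally_bounded (carrier G)"
    and "0 < r0" "1 \<le> C" "0 < s0" "0 < c"
    and packing: "\<And>r s F. \<lbrakk>0 < s; s \<le> r; r \<le> r0; finite F; F \<subseteq> mball \<one> r;
       pairwise (\<lambda>x y. s \<le> d x y) F\<rbrakk> \<Longrightarrow> real (card F) \<le> C * (r / s) ^ n"
    and separated: "\<And>s. \<lbrakk>0 < s; s \<le> s0\<rbrakk> \<Longrightarrow> \<exists>F. finite F \<and> F \<subseteq> carrier G \<and>
       pairwise (\<lambda>x y. s \<le> d x y) F \<and> c / s ^ n \<le> real (card F)"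
  shows "\<exists>R. R \<subseteq> carrier G \<and> R <#> R = carrier G \<and> upper_minkowski_dim R d = ereal (real n / 2)"
proof -
  obtain R K where R: "R \<subseteq> carrier G" "R <#> R = carrier G" and "1 \<le> K"
    and cover: "\<forall>m. \<exists>P. finite P \<and> P \<subseteq> carrier G \<and> real (card P) \<le> K ^ (m + 1) * 2 ^ (2 * n * m\<^sup>2) \<and>
       (\<forall>x\<in>R. \<exists>p\<in>P. d x p \<le> 2 * (r0 / 2 ^ (4 * m\<^sup>2)))"
    by (rule exists_thin_square_root[OF complete tb \<open>0 < r0\<close> \<open>1 \<le> C\<close> packing])
  define attains where "attains \<delta> E \<longleftrightarrow> packing_number R d \<delta> = enat (card E) \<and> finite E \<and> E \<subseteq> R \<and>
    (\<forall>x\<in>R. \<exists>c\<in>E. d x c < 2 * \<delta>)" for \<delta> E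
  have attained: "\<exists>E. attains \<delta> E \<and> card E \<le> card P"
    if "0 < \<delta>" "finite P" "P \<subseteq> carrier G" "\<forall>x\<in>R. \<exists>p\<in>P. d x p < \<delta> / 2" for \<delta> P
    by (rule packing_number_attained[OF R(1) that]) (unfold attains_def, intro exI conjI)
  \<comment> \<open>Points within \<open>2 * r0 / 2 ^ (4 * m\<^sup>2)\<close> are within \<open>\<delta> / 2\<close>, which is what bounds packings by \<open>\<delta>\<close>-balls.\<close>
  have fine: "\<exists>P. finite P \<and> P \<subseteq> carrier G \<and> real (card P) \<le> K ^ (m + 1) * 2 ^ (2 * n * m\<^sup>2) \<and>
      (\<forall>x\<in>R. \<exists>p\<in>P. d x p < \<delta> / 2)" if "4 * r0 / 2 ^ (4 * m\<^sup>2) < \<delta>" for \<delta> m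
  proof -
    have less: "2 * (r0 / 2 ^ (4 * m\<^sup>2)) < \<delta> / 2" using that by simp
    from cover obtain P where "finite P" "P \<subseteq> carrier G"
        "real (card P) \<le> K ^ (m + 1) * 2 ^ (2 * n * m\<^sup>2)"
        and near: "\<forall>x\<in>R. \<exists>p\<in>P. d x p \<le> 2 * (r0 / 2 ^ (4 * m\<^sup>2))"
      by (elim allE[of _ m] exE conjE) (rule that)
    moreover have "\<forall>x\<in>R. \<exists>p\<in>P. d x p < \<delta> / 2"
      using near less by (meson le_less_trans)
    ultimately show ?thesis by (intro exI[of _ P] conjI)
  qed
  have small: "\<exists>m. 4 * r0 / 2 ^ (4 * m\<^sup>2) < \<delta>" if "0 < \<delta>" for \<delta> :: real
  proof -
    have "(\<lambda>m::nat. 4 * r0 / 2 ^ (4 * m\<^sup>2)) \<longlonglongrightarrow> 0" by real_asymp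
    from order_tendstoD(2)[OF this that] show ?thesis by (auto simp: eventually_sequentially)
  qed
  have "\<exists>E. attains \<delta> E" if "0 < \<delta>" for \<delta>
  proof -
    obtain m where "4 * r0 / 2 ^ (4 * m\<^sup>2) < \<delta>" using small[OF \<open>0 < \<delta>\<close>] by (elim exE)
    from fine[OF this] obtain P where "finite P" "P \<subseteq> carrier G" "\<forall>x\<in>R. \<exists>p\<in>P. d x p < \<delta> / 2"
      by (elim exE conjE) (rule that)
    from attained[OF \<open>0 < \<delta>\<close> this] show ?thesis by (elim exE conjE) (rule exI)
  qed
  then obtain E where E: "\<And>\<delta>. 0 < \<delta> \<Longrightarrow> attains \<delta> (E \<delta>)" by metis
  define N where "N \<delta> = card (E \<delta>)" for \<delta>
  have N: "packing_number R d \<delta> = enat (N \<delta>)" if "0 < \<delta>" for \<delta>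
    using E[OF that] by (simp add: attains_def N_def)
  have "((\<lambda>\<delta>. - ln (real (N \<delta>)) / ln \<delta>) \<longlongrightarrow> real n / 2) (at_right 0)"
  proof (rule log_ratio_tendsto_half[of "c / 8 ^ n" K r0 "s0 / 8"])
    fix \<delta> :: real assume \<delta>: "0 < \<delta>" "\<delta> < s0 / 8"
    \<comment> \<open>A maximal packing by \<open>\<delta>\<close>-balls is a \<open>2\<delta>\<close>-net of \<open>R\<close>, so its products can tell
      \<open>8\<delta>\<close>-separated points of \<open>G\<close> apart.\<close>
    then obtain F where F: "finite F" "F \<subseteq> carrier G" "pairwise (\<lambda>x y. 4 * (2 * \<delta>) \<le> d x y) F"
      "c / (8 * \<delta>) ^ n \<le> real (card F)"
      using separated[of "8 * \<delta>"] by auto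
    have "card F \<le> (card (E \<delta>))\<^sup>2"
      by (rule card_separated_le_square[OF R _ _ _ F(2,3)])
         (use E[OF \<delta>(1)] R(1) in \<open>auto simp: attains_def\<close>)
    hence "real (card F) \<le> real ((N \<delta>)\<^sup>2)" unfolding N_def of_nat_le_iff .
    with F(4) have "c / (8 * \<delta>) ^ n \<le> real ((N \<delta>)\<^sup>2)" by (rule order_trans)
    thus "c / 8 ^ n / \<delta> ^ n \<le> (real (N \<delta>))\<^sup>2"
      by (simp add: power_mult_distrib)
  next
    fix \<delta> :: real and m assume \<delta>: "0 < \<delta>" "4 * r0 / 2 ^ (4 * m\<^sup>2) < \<delta>"
    from fine[OF \<delta>(2)] obtain P where P: "finite P" "P \<subseteq> carrier G"
        "\<forall>x\<in>R. \<exists>p\<in>P. d x p < \<delta> / 2" "real (card P) \<le> K ^ (m + 1) * 2 ^ (2 * n * m\<^sup>2)"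
      by (elim exE conjE) (rule that)
    from attained[OF \<delta>(1) P(1-3)] obtain E' where "attains \<delta> E'" "card E' \<le> card P"
      by (elim exE conjE) (rule that)
    hence "N \<delta> \<le> card P" using N[OF \<delta>(1)] by (simp add: attains_def)
    thus "real (N \<delta>) \<le> K ^ (m + 1) * 2 ^ (2 * n * m\<^sup>2)" using P(4) by simp
  qed (use assms \<open>1 \<le> K\<close> in simp_all)
  from upper_minkowski_dim_eqI[OF N this] show ?thesis using R by (intro exI[of _ R] conjI)
qed

section \<open>Counting in coordinate space\<close>

text \<open>
  The two halves of one-dimensionality that the real and the p-adic line share, in a form that
  passes to products: instead of a covering by sets, \<open>f\<close> assigns to each point the number of its cell, so
  that the tuple of cell numbers is a cell number in \<open>n\<close>-space.
\<close>

definition line_coverable :: "'k::metric_space itself \<Rightarrow> real \<Rightarrow> bool" where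
  "line_coverable _ C \<longleftrightarrow> (\<forall>(a::'k) r s. 0 < s \<and> s \<le> r \<longrightarrow>
     (\<exists>(f::'k \<Rightarrow> nat) N. real N \<le> C * (r / s) \<and> (\<forall>x\<in>cball a r. f x < N) \<and>
        (\<forall>x\<in>cball a r. \<forall>y\<in>cball a r. f x = f y \<longrightarrow> dist x y < s)))"

definition line_packable :: "'k::metric_space itself \<Rightarrow> real \<Rightarrow> bool" where
  "line_packable _ c \<longleftrightarrow> (\<forall>(a::'k) \<eta> s. 0 < s \<and> s \<le> \<eta> \<longrightarrow>
     (\<exists>(g::nat \<Rightarrow> 'k) N. c * (\<eta> / s) \<le> real N \<and> (\<forall>i<N. g i \<in> ball a \<eta>) \<and>
        (\<forall>i<N. \<forall>j<N. i \<noteq> j \<longrightarrow> s \<le> dist (g i) (g j))))"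

text \<open>Satisfied by the Euclidean, the maximum and the sum metric alike.\<close>

definition coordinatewise :: "nat \<Rightarrow> ((nat \<Rightarrow> 'k::metric_space) \<Rightarrow> (nat \<Rightarrow> 'k) \<Rightarrow> real) \<Rightarrow> bool" where
  "coordinatewise n \<rho> \<longleftrightarrow> (\<forall>x y. (\<forall>i<n. dist (x i) (y i) \<le> \<rho> x y) \<and>
     \<rho> x y \<le> (\<Sum>i<n. dist (x i) (y i)))"

lemma coordinatewise_less:
  assumes "coordinatewise n \<rho>" "0 < e" "\<And>i. i < n \<Longrightarrow> dist (x i) (y i) < e / (real n + 1)"
  shows "\<rho> x y < e"
proof -
  have "\<rho> x y \<le> (\<Sum>i<n. dist (x i) (y i))" using assms(1) by (simp add: coordinatewise_def)
  also have "\<dots> \<le> (\<Sum>i<n. e / (real n + 1))" using assms(3) by (intro sum_mono less_imp_le) simp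
  also have "\<dots> < e" using \<open>0 < e\<close> by (simp add: field_simps)
  finally show ?thesis .
qed

lemma card_separated_coordinates_le:
  fixes \<Phi> :: "(nat \<Rightarrow> 'k::metric_space) set"
  assumes line: "line_coverable TYPE('k) C" and \<rho>: "coordinatewise n \<rho>"
    and "0 < s" "s \<le> r" "finite \<Phi>"
    and r: "\<And>x. x \<in> \<Phi> \<Longrightarrow> \<rho> x a \<le> r" and sep: "pairwise (\<lambda>x y. s \<le> \<rho> x y) \<Phi>"
  shows "real (card \<Phi>) \<le> (C * (real n + 1) * (r / s)) ^ n"
proof -
  \<comment> \<open>Dividing by \<open>n + 1\<close> rather than by \<open>n\<close> includes the zero-dimensional case.\<close>
  define s' where "s' = s / (real n + 1)"
  have "s' \<le> s" using \<open>0 < s\<close> mult_left_mono[of 1 "real n + 1" s] by (simp add: s'_def divide_le_eq)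
  hence s': "0 < s'" "s' \<le> r" using \<open>0 < s\<close> \<open>s \<le> r\<close> by (simp_all add: s'_def)
  define codes where "codes i f N \<longleftrightarrow> real N \<le> C * (r / s') \<and> (\<forall>x\<in>cball (a i) r. f x < N) \<and>
      (\<forall>x\<in>cball (a i) r. \<forall>y\<in>cball (a i) r. f x = f y \<longrightarrow> dist x y < s')"
    for i and f :: "'k \<Rightarrow> nat" and N
  have "\<exists>f N. codes i f N" for i
    using line s' unfolding line_coverable_def codes_def by simp
  then obtain f N where fN: "\<And>i. codes i (f i) (N i)" by metis
  define code where "code x = (\<lambda>i\<in>{..<n}. f i (x i))" for x
  have in_ball: "x i \<in> cball (a i) r" if "x \<in> \<Phi>" "i < n" for x i
    using \<rho> r[OF that(1)] that(2) unfolding coordinatewise_def mem_cball dist_commute[of "a i"]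
    by (meson order_trans)
  have "inj_on code \<Phi>"
  proof (rule inj_onI, rule ccontr)
    fix x y assume xy: "x \<in> \<Phi>" "y \<in> \<Phi>" "code x = code y" "x \<noteq> y"
    have "dist (x i) (y i) < s / (real n + 1)" if "i < n" for i
    proof -
      have "f i (x i) = f i (y i)"
        using fun_cong[OF xy(3), of i] that by (simp add: code_def)
      thus ?thesis using fN[of i] in_ball[OF xy(1) that] in_ball[OF xy(2) that]
        by (simp add: codes_def s'_def)
    qed
    hence "\<rho> x y < s" by (rule coordinatewise_less[OF \<rho> \<open>0 < s\<close>])
    moreover have "s \<le> \<rho> x y" using sep xy(1,2,4) by (simp add: pairwise_def)
    ultimately show False by simp
  qed
  moreover have "code ` \<Phi> \<subseteq> (\<Pi>\<^sub>E i\<in>{..<n}. {..<N i})"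
    using fN in_ball unfolding code_def codes_def image_subset_iff by (simp add: restrict_PiE_iff)
  ultimately have "card \<Phi> \<le> card (\<Pi>\<^sub>E i\<in>{..<n}. {..<N i})"
    by (rule card_inj_on_le) (simp add: finite_PiE)
  also have "\<dots> = (\<Prod>i<n. N i)" by (simp add: card_PiE)
  finally have "real (card \<Phi>) \<le> (\<Prod>i<n. real (N i))" by (simp flip: of_nat_prod)
  also have "\<dots> \<le> (\<Prod>i<n. C * (r / s'))"
    using fN by (intro prod_mono) (simp add: codes_def)
  also have "\<dots> = (C * (real n + 1) * (r / s)) ^ n"
    by (simp add: s'_def field_simps)
  finally show ?thesis .
qed

definition coord_box :: "nat \<Rightarrow> (nat \<Rightarrow> 'k::{metric_space,zero}) \<Rightarrow> real \<Rightarrow> (nat \<Rightarrow> 'k) set" where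
  "coord_box n a \<eta> = {x. (\<forall>i\<ge>n. x i = 0) \<and> (\<forall>i<n. dist (x i) (a i) < \<eta>)}"

lemma exists_separated_coordinates:
  fixes a :: "nat \<Rightarrow> 'k::{metric_space,zero}"
  assumes line: "line_packable TYPE('k) c" and \<rho>: "coordinatewise n \<rho>" and "0 < s" "s \<le> \<eta>" "0 < c"
  obtains \<Phi> where "finite \<Phi>" "\<Phi> \<subseteq> coord_box n a \<eta>"
    "pairwise (\<lambda>x y. s \<le> \<rho> x y) \<Phi>" "(c * (\<eta> / s)) ^ n \<le> real (card \<Phi>)"
proof -
  define grid where "grid i g N \<longleftrightarrow> c * (\<eta> / s) \<le> real N \<and> (\<forall>j<N. g j \<in> ball (a i) \<eta>) \<and>
        (\<forall>j<N. \<forall>k<N. j \<noteq> k \<longrightarrow> s \<le> dist (g j) (g k))" for i and g :: "nat \<Rightarrow> 'k" and N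
  have "\<exists>g N. grid i g N" for i
    using line assms(3,4) unfolding line_packable_def grid_def by simp
  then obtain g N where gN: "\<And>i. grid i (g i) (N i)" by metis
  let ?I = "\<Pi>\<^sub>E i\<in>{..<n}. {..<N i}"
  define point where "point u = (\<lambda>i. if i < n then g i (u i) else 0)" for u :: "nat \<Rightarrow> nat"
  have far: "s \<le> \<rho> (point u) (point v)" if uv: "u \<in> ?I" "v \<in> ?I" "u \<noteq> v" for u v
  proof -
    have "\<exists>i\<in>{..<n}. u i \<noteq> v i" using PiE_ext[OF uv(1,2)] uv(3) by blast
    then obtain i where i: "i < n" "u i \<noteq> v i" by (elim bexE) (rule that, simp_all)
    have "u i < N i" "v i < N i" using uv(1,2) i(1) by (simp_all add: PiE_iff)
    hence "s \<le> dist (g i (u i)) (g i (v i))" using gN[of i] i(2) by (simp add: grid_def)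
    also have "\<dots> = dist (point u i) (point v i)" using i by (simp add: point_def)
    also have "\<dots> \<le> \<rho> (point u) (point v)" using \<rho> i by (simp add: coordinatewise_def)
    finally show ?thesis .
  qed
  have same: "\<rho> x x \<le> 0" for x
  proof -
    have "\<rho> x x \<le> (\<Sum>i<n. dist (x i) (x i))" using \<rho> by (simp only: coordinatewise_def)
    thus ?thesis by simp
  qed
  have inj: "inj_on point ?I"
  proof (rule inj_onI, rule ccontr)
    fix u v assume "u \<in> ?I" "v \<in> ?I" "point u = point v" "u \<noteq> v"
    thus False using far[of u v] same[of "point v"] \<open>0 < s\<close> by simp
  qed
  show ?thesis
  proof (rule that[of "point ` ?I"])
    show "finite (point ` ?I)" by (simp add: finite_PiE)
    show "point ` ?I \<subseteq> coord_box n a \<eta>"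
    proof (rule image_subsetI)
      fix u assume u: "u \<in> ?I"
      have "dist (g i (u i)) (a i) < \<eta>" if "i < n" for i
        using that gN[of i] u by (simp add: grid_def dist_commute PiE_iff)
      thus "point u \<in> coord_box n a \<eta>" by (simp add: coord_box_def point_def)
    qed
    show "pairwise (\<lambda>x y. s \<le> \<rho> x y) (point ` ?I)"
      unfolding pairwise_image by (rule pairwiseI) (simp add: far)
    have "(c * (\<eta> / s)) ^ n = (\<Prod>i<n. c * (\<eta> / s))" by simp
    also have "\<dots> \<le> (\<Prod>i<n. real (N i))"
      using gN assms(3-5) by (intro prod_mono) (simp add: grid_def)
    also have "\<dots> = real (card (point ` ?I))" by (simp add: card_image[OF inj] card_PiE)
    finally show "(c * (\<eta> / s)) ^ n \<le> real (card (point ` ?I))" .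
  qed
qed

lemma openin_coord_box: "openin (coord_space n) (coord_box n a \<eta>)"
proof -
  have "openin (product_topology (\<lambda>_. euclidean) UNIV)
      (\<Pi>\<^sub>E i\<in>UNIV. if i < n then ball (a i) \<eta> else UNIV)"
    by (rule product_topology_basis) (auto intro!: finite_subset[of _ "{..<n}"])
  moreover have "coord_box n a \<eta> = (\<Pi>\<^sub>E i\<in>UNIV. if i < n then ball (a i) \<eta> else UNIV) \<inter> {x. \<forall>i\<ge>n. x i = 0}"
    by (auto simp: coord_box_def PiE_iff dist_commute split: if_splits)
  ultimately show ?thesis unfolding coord_space_def openin_subtopology by (intro exI conjI)
qed

lemma open_contains_coord_box:
  assumes W: "openin (coord_space n) W" and "a \<in> W"
  obtains \<eta> where "0 < \<eta>" "coord_box n a \<eta> \<subseteq> W"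
proof -
  obtain W' where W': "openin (product_topology (\<lambda>_. euclidean) UNIV) W'"
    and W_eq: "W = W' \<inter> {x. \<forall>i\<ge>n. x i = 0}"
    using W unfolding coord_space_def openin_subtopology by (elim exE conjE) (rule that)
  have "a \<in> W'" using \<open>a \<in> W\<close> W_eq by blast
  from product_topology_open_contains_basis[OF W' this]
  obtain X where X: "a \<in> (\<Pi>\<^sub>E i\<in>UNIV. X i)" "\<forall>i. openin euclidean (X i)" "(\<Pi>\<^sub>E i\<in>UNIV. X i) \<subseteq> W'"
    by (elim exE conjE) (rule that)
  have "\<exists>e>0. ball (a i) e \<subseteq> X i" for i
  proof -
    have "open (X i)" "a i \<in> X i" using X(1,2) by (simp_all add: PiE_iff)
    thus ?thesis by (simp add: open_contains_ball)
  qed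
  then obtain e where e: "\<And>i. 0 < e i" "\<And>i. ball (a i) (e i) \<subseteq> X i" by metis
  define \<eta> where "\<eta> = Min (insert 1 (e ` {..<n}))"
  have "0 < \<eta>" unfolding \<eta>_def using e(1) by (subst Min_gr_iff) auto
  moreover have "coord_box n a \<eta> \<subseteq> W"
  proof
    fix x assume x: "x \<in> coord_box n a \<eta>"
    have "x i \<in> X i" for i
    proof (cases "i < n")
      case True
      hence "\<eta> \<le> e i" unfolding \<eta>_def by (intro Min_le) auto
      hence "x i \<in> ball (a i) (e i)" using x True by (auto simp: coord_box_def dist_commute)
      thus ?thesis using e(2) by blast
    next
      case False
      hence "x i = a i" using x \<open>a \<in> W\<close> W_eq by (simp add: coord_box_def)
      thus ?thesis using X(1) by (simp add: PiE_iff)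
    qed
    hence "x \<in> W'" using X(3) by auto
    thus "x \<in> W" using x W_eq by (simp add: coord_box_def)
  qed
  ultimately show ?thesis by (rule that)
qed

section \<open>Compact groups with a compatible metric\<close>

text \<open>
  Enlarging the Lipschitz constant to be at least 1 is harmless because the coordinate distance,
  being bounded below by \<open>d x y / L\<close>, is nonnegative.
\<close>

lemma compatible_metric_chart:
  assumes "compatible_metric reg \<rho> n G T A d"
  obtains U \<phi> V L where "is_chart n T (U, \<phi>)" "openin T V" "\<one>\<^bsub>G\<^esub> \<in> V" "V \<subseteq> U" "1 \<le> L"
    "\<forall>x\<in>V. \<forall>y\<in>V. \<rho> n (\<phi> x) (\<phi> y) \<le> L * d x y \<and> d x y \<le> L * \<rho> n (\<phi> x) (\<phi> y)"
proof -
  from assms obtain U \<phi> V L where M: "Metric_space (carrier G) d"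
    and atlas: "is_atlas reg n T (insert (U, \<phi>) A)" and V: "openin T V" "\<one>\<^bsub>G\<^esub> \<in> V" "V \<subseteq> U"
    and "L > 0" and L: "\<forall>x\<in>V. \<forall>y\<in>V. \<rho> n (\<phi> x) (\<phi> y) \<le> L * d x y \<and> d x y \<le> L * \<rho> n (\<phi> x) (\<phi> y)"
    unfolding compatible_metric_def by (elim exE conjE) (rule that)
  have chart: "is_chart n T (U, \<phi>)" using atlas by (simp add: is_atlas_def)
  have d: "0 \<le> d x y" for x y using M by (rule Metric_space.nonneg)
  show ?thesis
  proof (rule that[OF chart V, of "max 1 L"], simp, intro ballI conjI)
    fix x y assume xy: "x \<in> V" "y \<in> V"
    have *: "\<rho> n (\<phi> x) (\<phi> y) \<le> L * d x y" "d x y \<le> L * \<rho> n (\<phi> x) (\<phi> y)" using L xy by simp_all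
    have "0 \<le> L * \<rho> n (\<phi> x) (\<phi> y)" using *(2) d[of x y] by (rule order_trans[rotated])
    hence \<rho>: "0 \<le> \<rho> n (\<phi> x) (\<phi> y)" using \<open>L > 0\<close> by (simp add: zero_le_mult_iff)
    show "\<rho> n (\<phi> x) (\<phi> y) \<le> max 1 L * d x y"
      by (rule order_trans[OF *(1) mult_right_mono]) (simp_all add: d)
    show "d x y \<le> max 1 L * \<rho> n (\<phi> x) (\<phi> y)"
      by (rule order_trans[OF *(2) mult_right_mono]) (simp_all add: \<rho>)
  qed
qed

lemma compatible_metric_biinvariant:
  assumes "lie_group reg n G T A" "compatible_metric reg \<rho> n G T A d"
  shows "biinvariant_metric_group G d"
proof -
  have "group G" using assms(1) by (simp add: lie_group_def)
  moreover have "Metric_space (carrier G) d"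
    "\<forall>g\<in>carrier G. \<forall>x\<in>carrier G. \<forall>y\<in>carrier G.
        d (g \<otimes>\<^bsub>G\<^esub> x) (g \<otimes>\<^bsub>G\<^esub> y) = d x y \<and> d (x \<otimes>\<^bsub>G\<^esub> g) (y \<otimes>\<^bsub>G\<^esub> g) = d x y"
    using assms(2) by (simp_all add: compatible_metric_def)
  ultimately show ?thesis
    by (simp add: biinvariant_metric_group_def biinvariant_metric_group_axioms_def)
qed

lemma chart_image_open:
  assumes "is_chart n T (U, \<phi>)" "openin T V" "V \<subseteq> U"
  shows "openin (coord_space n) (\<phi> ` V)"
proof -
  have "openin (subtopology T U) V"
    using assms(2,3) by (simp add: openin_subset_topspace_eq openin_subtopology_Int2 openin_subtopology) blast
  hence "openin (subtopology (coord_space n) (\<phi> ` U)) (\<phi> ` V)"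
    using assms(1) homeomorphic_imp_open_map unfolding is_chart_def open_map_def by auto
  thus ?thesis using assms(1) openin_trans_full unfolding is_chart_def by auto
qed

lemma chart_inj_on:
  assumes "is_chart n T (U, \<phi>)"
  shows "inj_on \<phi> U"
proof -
  have "openin T U" "homeomorphic_map (subtopology T U) (subtopology (coord_space n) (\<phi> ` U)) \<phi>"
    using assms by (simp_all add: is_chart_def)
  thus ?thesis using homeomorphic_imp_injective_map openin_subset
    by (metis inf.absorb_iff2 topspace_subtopology)
qed

lemma chart_preimage_box:
  assumes "is_chart n T (U, \<phi>)" "openin T V" "V \<subseteq> U"
  shows "openin T {x \<in> V. \<phi> x \<in> coord_box n a \<eta>}"
proof -
  have "openin T U" and "continuous_map (subtopology T U) (coord_space n) \<phi>"
    using assms(1) homeomorphic_imp_continuous_map continuous_map_in_subtopology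
    by (fastforce simp: is_chart_def)+
  from openin_continuous_map_preimage[OF this(2) openin_coord_box[of n a \<eta>]]
  have "openin T {x \<in> topspace (subtopology T U). \<phi> x \<in> coord_box n a \<eta>}"
    by (rule openin_trans_full) (rule \<open>openin T U\<close>)
  from openin_Int[OF assms(2) this]
  have "openin T (V \<inter> {x \<in> topspace (subtopology T U). \<phi> x \<in> coord_box n a \<eta>})" .
  also have "V \<inter> {x \<in> topspace (subtopology T U). \<phi> x \<in> coord_box n a \<eta>} = {x \<in> V. \<phi> x \<in> coord_box n a \<eta>}"
    using assms(3) openin_subset[OF assms(2)] by auto
  finally show ?thesis .
qed

text \<open>
  Near the identity the chart shows that \<open>T\<close>-neighbourhoods are small for \<open>d\<close>; translations, which are
  continuous for \<open>T\<close> and isometries for \<open>d\<close>, carry this to all points. So the identity map from \<open>T\<close> to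
  the metric topology is a continuous bijection from a compact to a Hausdorff space, hence open. In
  particular every chart domain around the identity contains a metric ball, which excludes
  points that are far away in \<open>T\<close> but close for \<open>d\<close>.
\<close>

lemma compact_lie_group_metric_topology:
  fixes G :: "('g, 'b) monoid_scheme" (structure)
    and \<rho> :: "nat \<Rightarrow> (nat \<Rightarrow> 'k::{metric_space,zero}) \<Rightarrow> (nat \<Rightarrow> 'k) \<Rightarrow> real"
  assumes compact: "compact_space T" and lie: "lie_group reg n G T A"
    and metric: "compatible_metric reg \<rho> n G T A d" and \<rho>: "coordinatewise n (\<rho> n)"
  shows "compact_space (Metric_space.mtopology (carrier G) d)"
    and "\<And>V. openin T V \<Longrightarrow> openin (Metric_space.mtopology (carrier G) d) V"
proof -
  interpret biinvariant_metric_group G d by (rule compatible_metric_biinvariant[OF lie metric])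
  have top: "topspace T = carrier G"
    and mult: "continuous_map (prod_topology T T) T (\<lambda>(x, y). x \<otimes> y)"
    using lie by (simp_all add: lie_group_def manifold_map_def)
  obtain U \<phi> V L where chart: "is_chart n T (U, \<phi>)" and V: "openin T V" "\<one> \<in> V" "V \<subseteq> U" and "1 \<le> L"
    and biLipschitz: "\<forall>x\<in>V. \<forall>y\<in>V. \<rho> n (\<phi> x) (\<phi> y) \<le> L * d x y \<and> d x y \<le> L * \<rho> n (\<phi> x) (\<phi> y)"
    by (rule compatible_metric_chart[OF metric])
  have L: "\<rho> n (\<phi> x) (\<phi> y) \<le> L * d x y" "d x y \<le> L * \<rho> n (\<phi> x) (\<phi> y)" if "x \<in> V" "y \<in> V" for x y
    using biLipschitz that by simp_all
  have at_one: "\<exists>W. openin T W \<and> \<one> \<in> W \<and> (\<forall>y\<in>W. d \<one> y < e)" if "0 < e" for e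
  proof -
    define \<eta> where "\<eta> = e / L / (real n + 1)"
    have "0 < \<eta>" using that \<open>1 \<le> L\<close> by (simp add: \<eta>_def)
    let ?W = "{x \<in> V. \<phi> x \<in> coord_box n (\<phi> \<one>) \<eta>}"
    have "\<phi> \<one> \<in> \<phi> ` U" using V by blast
    also have "\<phi> ` U \<subseteq> topspace (coord_space n)"
      using chart openin_subset by (auto simp: is_chart_def)
    finally have "\<one> \<in> ?W" using V(2) \<open>0 < \<eta>\<close> by (simp add: coord_box_def coord_space_def)
    moreover have "d \<one> y < e" if y: "y \<in> ?W" for y
    proof -
      have "\<rho> n (\<phi> \<one>) (\<phi> y) < e / L"
        by (rule coordinatewise_less[OF \<rho>])
           (use y \<open>0 < e\<close> \<open>1 \<le> L\<close> in \<open>simp_all add: \<eta>_def coord_box_def dist_commute\<close>)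
      hence "L * \<rho> n (\<phi> \<one>) (\<phi> y) < e" using \<open>1 \<le> L\<close> by (simp add: field_simps)
      with L(2)[of \<one> y] V(2) y show ?thesis by simp
    qed
    ultimately show ?thesis using chart_preimage_box[OF chart V(1,3)] by (intro exI[of _ ?W] conjI ballI)
  qed
  have cont: "continuous_map T mtopology id"
    unfolding continuous_map_to_metric
  proof (intro ballI allI impI)
    fix x and e :: real assume "x \<in> topspace T" "0 < e"
    hence x: "x \<in> carrier G" by (simp add: top)
    obtain W where W: "openin T W" "\<one> \<in> W" "\<forall>y\<in>W. d \<one> y < e"
      using at_one[OF \<open>0 < e\<close>] by (elim exE conjE) (rule that)
    have "continuous_map T (prod_topology T T) (\<lambda>y. (inv x, y))"
      using x by (intro continuous_map_pairedI) (simp_all add: top)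
    from continuous_map_compose[OF this mult]
    have "continuous_map T T (\<lambda>y. inv x \<otimes> y)" by (simp add: o_def)
    from openin_continuous_map_preimage[OF this W(1)]
    have "openin T {y \<in> carrier G. inv x \<otimes> y \<in> W}" by (simp add: top)
    moreover have "id y \<in> mball (id x) e" if "y \<in> carrier G" "inv x \<otimes> y \<in> W" for y
      using W(3)[rule_format, OF that(2)] that x dist_left_quotient[of x y] by simp
    ultimately show "\<exists>U. openin T U \<and> x \<in> U \<and> (\<forall>y\<in>U. id y \<in> mball (id x) e)"
      using x W(2) by (intro exI[of _ "{y \<in> carrier G. inv x \<otimes> y \<in> W}"]) simp
  qed
  have "compactin mtopology (id ` carrier G)"
    using compact cont by (intro image_compactin[of T]) (simp_all add: compact_space_def top)
  thus "compact_space mtopology" by (simp add: compact_space_def)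
  fix W assume W: "openin T W"
  hence "compactin T (carrier G - W)"
    by (intro closedin_compact_space[OF compact]) (simp add: closedin_def top Diff_Diff_Int openin_Int flip: top)
  hence "compactin mtopology (id ` (carrier G - W))" using cont by (rule image_compactin)
  hence "closedin mtopology (carrier G - W)"
    using Hausdorff_space_mtopology compactin_imp_closedin by simp
  moreover have "W \<subseteq> carrier G" using openin_subset[OF W] top by simp
  ultimately show "openin mtopology W"
    by (simp add: closedin_def double_diff)
qed

text \<open>
  The bi-Lipschitz chart transports the counting results from \<open>n\<close>-space to \<open>G\<close>, at the cost of
  constants: separated sets in small balls map to separated sets of coordinates, and separated
  sets of coordinates near those of the identity lift back.
\<close>

theorem compact_lie_group_square_root:
  fixes G :: "('g, 'b) monoid_scheme" (structure)
    and \<rho> :: "nat \<Rightarrow> (nat \<Rightarrow> 'k::{metric_space,zero}) \<Rightarrow> (nat \<Rightarrow> 'k) \<Rightarrow> real"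
  assumes compact: "compact_space T" and lie: "lie_group reg n G T A"
    and metric: "compatible_metric reg \<rho> n G T A d" and \<rho>: "coordinatewise n (\<rho> n)"
    and line: "line_coverable TYPE('k) C" "1 \<le> C" "line_packable TYPE('k) c" "0 < c"
  shows "\<exists>R. R \<subseteq> carrier G \<and> R <#>\<^bsub>G\<^esub> R = carrier G \<and> upper_minkowski_dim R d = ereal (real n / 2)"
proof -
  interpret biinvariant_metric_group G d by (rule compatible_metric_biinvariant[OF lie metric])
  note topology = compact_lie_group_metric_topology[OF compact lie metric \<rho>]
  have complete: mcomplete and tb: "mtotally_bounded (carrier G)"
    using topology(1) by (simp_all add: compact_space_eq_mcomplete_mtotally_bounded)
  obtain U \<phi> V L where chart: "is_chart n T (U, \<phi>)" and V: "openin T V" "\<one> \<in> V" "V \<subseteq> U" and "1 \<le> L"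
    and biLipschitz: "\<forall>x\<in>V. \<forall>y\<in>V. \<rho> n (\<phi> x) (\<phi> y) \<le> L * d x y \<and> d x y \<le> L * \<rho> n (\<phi> x) (\<phi> y)"
    by (rule compatible_metric_chart[OF metric])
  have L: "\<rho> n (\<phi> x) (\<phi> y) \<le> L * d x y" "d x y \<le> L * \<rho> n (\<phi> x) (\<phi> y)" if "x \<in> V" "y \<in> V" for x y
    using biLipschitz that by simp_all
  have "0 < L" using \<open>1 \<le> L\<close> by simp
  have inj: "inj_on \<phi> V" using chart_inj_on[OF chart] V(3) by (rule inj_on_subset)
  obtain r0 where r0: "0 < r0" "mball \<one> r0 \<subseteq> V"
    using topology(2)[OF V(1)] V(2) by (auto simp: openin_mtopology)
  obtain \<eta> where \<eta>: "0 < \<eta>" "coord_box n (\<phi> \<one>) \<eta> \<subseteq> \<phi> ` V"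
    by (rule open_contains_coord_box[OF chart_image_open[OF chart V(1,3)] imageI[OF V(2)]])
  have carrier: "V \<subseteq> carrier G" using openin_subset[OF V(1)] lie by (simp add: lie_group_def)
  show ?thesis
  proof (rule exists_square_root_of_half_dimension[OF complete tb \<open>0 < r0\<close>])
    let ?C = "(C * (real n + 1) * L\<^sup>2) ^ n"
    have "1 \<le> C * (real n + 1)" using mult_mono[of 1 C 1 "real n + 1"] \<open>1 \<le> C\<close> by simp
    moreover have "1 \<le> L\<^sup>2" using \<open>1 \<le> L\<close> by (rule one_le_power)
    ultimately have "1 \<le> C * (real n + 1) * L\<^sup>2" using mult_mono[of 1 "C * (real n + 1)" 1 "L\<^sup>2"] by simp
    thus "1 \<le> ?C" by (rule one_le_power)
    fix r s F assume rs: "0 < s" "s \<le> r" "r \<le> r0" and F: "finite F" "F \<subseteq> mball \<one> r"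
      "pairwise (\<lambda>x y. s \<le> d x y) F"
    have FV: "F \<subseteq> V" using F(2) rs(3) r0(2) mball_subset_concentric by blast
    have "real (card (\<phi> ` F)) \<le> (C * (real n + 1) * (L * r / (s / L))) ^ n"
    proof (rule card_separated_coordinates_le[OF line(1) \<rho>])
      have "s / L \<le> s" "r \<le> L * r" using \<open>1 \<le> L\<close> rs by (simp_all add: field_simps)
      thus "s / L \<le> L * r" using rs(2) by simp
      show "\<rho> n x (\<phi> \<one>) \<le> L * r" if x: "x \<in> \<phi> ` F" for x
      proof -
        obtain g where g: "g \<in> F" "x = \<phi> g" using x by (elim imageE) (rule that)
        have "d g \<one> \<le> r" using F(2) g(1) by (auto simp: commute)
        hence "L * d g \<one> \<le> L * r" using \<open>0 < L\<close> by simp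
        moreover have "\<rho> n (\<phi> g) (\<phi> \<one>) \<le> L * d g \<one>" using FV g(1) V(2) by (intro L(1)) auto
        ultimately show ?thesis using g(2) by simp
      qed
      show "pairwise (\<lambda>x y. s / L \<le> \<rho> n x y) (\<phi> ` F)"
        unfolding pairwise_image
      proof (rule pairwiseI, rule impI)
        fix x y assume xy: "x \<in> F" "y \<in> F" "x \<noteq> y"
        have "s \<le> d x y" using F(3) xy by (simp add: pairwise_def)
        also have "\<dots> \<le> L * \<rho> n (\<phi> x) (\<phi> y)" using FV xy by (intro L(2)) auto
        finally show "s / L \<le> \<rho> n (\<phi> x) (\<phi> y)" using \<open>0 < L\<close> by (simp add: field_simps)
      qed
    qed (use F(1) rs \<open>0 < L\<close> in simp_all)
    also have "card (\<phi> ` F) = card F" using inj_on_subset[OF inj FV] by (rule card_image)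
    also have "C * (real n + 1) * (L * r / (s / L)) = (C * (real n + 1) * L\<^sup>2) * (r / s)"
      by (simp add: power2_eq_square)
    finally show "real (card F) \<le> ?C * (r / s) ^ n" by (simp only: power_mult_distrib)
  next
    let ?c = "(c * \<eta> / L) ^ n"
    show "0 < \<eta> / L" "0 < ?c" using \<open>0 < c\<close> \<eta>(1) \<open>0 < L\<close> by simp_all
    fix s :: real assume s: "0 < s" "s \<le> \<eta> / L"
    have "L * s \<le> \<eta>" using s(2) \<open>0 < L\<close> by (simp add: field_simps)
    moreover have "0 < L * s" using s(1) \<open>0 < L\<close> by simp
    ultimately obtain \<Phi> where \<Phi>: "finite \<Phi>" "\<Phi> \<subseteq> coord_box n (\<phi> \<one>) \<eta>"
      "pairwise (\<lambda>x y. L * s \<le> \<rho> n x y) \<Phi>" "(c * (\<eta> / (L * s))) ^ n \<le> real (card \<Phi>)"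
      using exists_separated_coordinates[OF line(3) \<rho> _ _ \<open>0 < c\<close>] by metis
    have image: "\<Phi> \<subseteq> \<phi> ` V" using \<Phi>(2) \<eta>(2) by (rule order_trans)
    define \<psi> where "\<psi> = inv_into V \<phi>"
    have \<psi>: "\<psi> x \<in> V" "\<phi> (\<psi> x) = x" if "x \<in> \<Phi>" for x
      using that image inv_into_into[of x \<phi> V] f_inv_into_f[of x \<phi> V] by (auto simp: \<psi>_def)
    have "inj_on \<psi> \<Phi>" using \<psi>(2) by (rule inj_on_inverseI)
    hence card: "card (\<psi> ` \<Phi>) = card \<Phi>" by (rule card_image)
    show "\<exists>F. finite F \<and> F \<subseteq> carrier G \<and> pairwise (\<lambda>x y. s \<le> d x y) F \<and> ?c / s ^ n \<le> real (card F)"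
    proof (intro exI[of _ "\<psi> ` \<Phi>"] conjI)
      show "finite (\<psi> ` \<Phi>)" using \<Phi>(1) by simp
      show "\<psi> ` \<Phi> \<subseteq> carrier G" using \<psi>(1) carrier by auto
      show "pairwise (\<lambda>x y. s \<le> d x y) (\<psi> ` \<Phi>)"
        unfolding pairwise_image
      proof (rule pairwiseI, rule impI)
        fix x y assume xy: "x \<in> \<Phi>" "y \<in> \<Phi>" "x \<noteq> y"
        have "L * s \<le> \<rho> n x y" using \<Phi>(3) xy by (simp add: pairwise_def)
        also have "\<dots> \<le> L * d (\<psi> x) (\<psi> y)" using L(1)[of "\<psi> x" "\<psi> y"] \<psi> xy by simp
        finally show "s \<le> d (\<psi> x) (\<psi> y)" using \<open>0 < L\<close> by simp
      qed
      have "?c / s ^ n = (c * (\<eta> / (L * s))) ^ n" by (simp add: power_mult_distrib power_divide)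
      thus "?c / s ^ n \<le> real (card (\<psi> ` \<Phi>))" using \<Phi>(4) card by simp
    qed
  qed
qed

section \<open>The real line and the p-adic line\<close>

lemma coordinatewise_real: "coordinatewise n (real_coord_dist n)"
  unfolding coordinatewise_def
proof (intro allI conjI impI)
  fix x y :: "nat \<Rightarrow> real"
  show "real_coord_dist n x y \<le> (\<Sum>i<n. dist (x i) (y i))"
    unfolding real_coord_dist_def dist_real_def by (rule L2_set_le_sum_abs)
  fix i assume "i < n"
  hence "\<bar>x i - y i\<bar> \<le> L2_set (\<lambda>i. \<bar>x i - y i\<bar>) {..<n}" by (intro member_le_L2_set) auto
  thus "dist (x i) (y i) \<le> real_coord_dist n x y"
    by (simp add: real_coord_dist_def dist_real_def L2_set_def)
qed

lemma coordinatewise_padic: "coordinatewise n (padic_coord_dist n)"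
  unfolding coordinatewise_def padic_coord_dist_def
  by (auto intro!: Max_ge sum_nonneg member_le_sum)

lemma real_line_coverable: "line_coverable TYPE(real) 3"
  unfolding line_coverable_def
proof (intro allI impI)
  fix a r s :: real assume rs: "0 < s \<and> s \<le> r"
  define f where "f x = nat \<lfloor>(x - a + r) / s\<rfloor>" for x
  define N where "N = nat \<lfloor>2 * r / s\<rfloor> + 1"
  have "real N \<le> 2 * r / s + 1" using rs by (simp add: N_def)
  also have "\<dots> \<le> 3 * (r / s)" using rs by (simp add: field_simps)
  finally have "real N \<le> 3 * (r / s)" .
  moreover have "f x < N" if "x \<in> cball a r" for x
  proof -
    have "x - a + r \<le> 2 * r" using that by (simp add: dist_real_def)
    hence "(x - a + r) / s \<le> 2 * r / s" using rs by (intro divide_right_mono) auto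
    thus ?thesis unfolding f_def N_def by (simp add: nat_mono floor_mono less_Suc_eq_le)
  qed
  moreover have "dist x y < s" if "x \<in> cball a r" "y \<in> cball a r" "f x = f y" for x y
  proof -
    have nonneg: "0 \<le> (x - a + r) / s" "0 \<le> (y - a + r) / s"
      using that(1,2) rs by (auto simp: dist_real_def)
    hence "\<lfloor>(x - a + r) / s\<rfloor> = \<lfloor>(y - a + r) / s\<rfloor>" using that(3) by (simp add: f_def nat_eq_iff)
    hence "\<bar>(x - a + r) / s - (y - a + r) / s\<bar> < 1" by linarith
    moreover have "(x - a + r) / s - (y - a + r) / s = (x - y) / s"
      by (simp add: diff_divide_distrib add_divide_distrib)
    ultimately show ?thesis using rs by (simp add: dist_real_def)
  qed
  ultimately show "\<exists>f N. real N \<le> 3 * (r / s) \<and> (\<forall>x\<in>cball a r. f x < N) \<and>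
      (\<forall>x\<in>cball a r. \<forall>y\<in>cball a r. f x = f y \<longrightarrow> dist x y < s)"
    by (intro exI[of _ f] exI[of _ N]) simp
qed

lemma real_line_packable: "line_packable TYPE(real) 1"
  unfolding line_packable_def
proof (intro allI impI)
  fix a \<eta> s :: real assume s: "0 < s \<and> s \<le> \<eta>"
  define g where "g j = a + real j * s" for j
  define N where "N = nat \<lceil>\<eta> / s\<rceil>"
  have "1 * (\<eta> / s) \<le> real N" by (simp add: N_def real_nat_ceiling_ge)
  moreover have "g j \<in> ball a \<eta>" if "j < N" for j
  proof -
    have "real j < \<eta> / s" using that unfolding N_def by linarith
    thus ?thesis using s by (simp add: g_def dist_real_def abs_mult field_simps)
  qed
  moreover have "s \<le> dist (g i) (g j)" if "i \<noteq> j" for i j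
  proof -
    have "1 \<le> \<bar>real i - real j\<bar>" using that by linarith
    hence "s * 1 \<le> s * \<bar>real i - real j\<bar>" using s by (intro mult_left_mono) auto
    also have "\<dots> = dist (g i) (g j)"
      using s by (simp add: g_def dist_real_def abs_mult flip: left_diff_distrib)
    finally show ?thesis by simp
  qed
  ultimately show "\<exists>g N. 1 * (\<eta> / s) \<le> real N \<and> (\<forall>i<N. g i \<in> ball a \<eta>) \<and>
      (\<forall>i<N. \<forall>j<N. i \<noteq> j \<longrightarrow> s \<le> dist (g i) (g j))"
    by (intro exI[of _ g] exI[of _ N]) simp
qed

lemma padic_abs_of_int:
  assumes "prime p" "a \<noteq> 0"
  shows "padic_abs p (of_int a) = inverse (real p ^ multiplicity (int p) a)"
proof -
  have "padic_val p (of_int a / of_int 1) = int (multiplicity (int p) a)"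
    using padic_val_frac[OF assms, of 1] by simp
  thus ?thesis using assms by (simp add: padic_abs_def power_int_minus)
qed

lemma padic_abs_of_int_le:
  assumes "prime p" "int p ^ k dvd a"
  shows "padic_abs p (of_int a) \<le> inverse (real p ^ k)"
proof (cases "a = 0")
  case True
  thus ?thesis using padic_abs_0[OF assms(1)] by simp
next
  case False
  have "\<not> is_unit (int p)" using assms(1) by (auto simp: prime_nat_iff)
  hence "k \<le> multiplicity (int p) a" using assms(2) False by (intro multiplicity_geI) auto
  hence "real p ^ k \<le> real p ^ multiplicity (int p) a"
    using padic_p_gt_1[OF assms(1)] by (intro power_increasing) auto
  thus ?thesis unfolding padic_abs_of_int[OF assms(1) False]
    using padic_p_gt_1[OF assms(1)] by (intro le_imp_inverse_le) auto
qed

lemma padic_abs_of_int_ge: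
  assumes "prime p" "\<not> int p ^ Suc k dvd a"
  shows "inverse (real p ^ k) \<le> padic_abs p (of_int a)"
proof -
  have "a \<noteq> 0" using assms(2) by auto
  have "multiplicity (int p) a < Suc k" using assms(2) multiplicity_dvd'[of "Suc k" "int p" a] by force
  hence "real p ^ multiplicity (int p) a \<le> real p ^ k"
    using padic_p_gt_1[OF assms(1)] by (intro power_increasing) auto
  thus ?thesis unfolding padic_abs_of_int[OF assms(1) \<open>a \<noteq> 0\<close>]
    using padic_p_gt_1[OF assms(1)] by (intro le_imp_inverse_le) auto
qed

text \<open>
  A rational \<open>a / b\<close> in lowest terms is p-integral only if \<open>p\<close> does not divide \<open>b\<close>. Then \<open>b\<close> has an
  inverse \<open>u\<close> modulo \<open>p ^ k\<close>, and \<open>a * u mod p ^ k\<close> is the required residue.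
\<close>

lemma padic_abs_le_1_approx:
  assumes p: "prime p" and q: "padic_abs p q \<le> 1"
  shows "\<exists>m < p ^ k. padic_abs p (q - of_nat m) \<le> inverse (real p ^ k)"
proof -
  obtain a b where ab: "quotient_of q = (a, b)" by (cases "quotient_of q")
  have "b > 0" and "coprime a b" and q_eq: "q = of_int a / of_int b"
    using quotient_of_denom_pos[OF ab] quotient_of_coprime[OF ab] quotient_of_div[OF ab] .
  have "\<not> int p dvd b"
  proof
    assume b: "int p dvd b"
    have "\<not> int p dvd a"
    proof
      assume "int p dvd a"
      hence "is_unit (int p)" using b \<open>coprime a b\<close> by (rule coprime_common_divisor[rotated])
      thus False using p by (auto simp: prime_nat_iff)
    qed
    hence "1 \<le> padic_abs p (of_int a)" using padic_abs_of_int_ge[OF p, of 0 a] by simp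
    also have "of_int a = q * of_int b" using q_eq \<open>b > 0\<close> by simp
    also have "padic_abs p (q * of_int b) = padic_abs p q * padic_abs p (of_int b)" by (rule padic_abs_mult[OF p])
    also have "\<dots> \<le> 1 * inverse (real p ^ 1)"
      using q padic_abs_of_int_le[OF p, of 1 b] b padic_abs_nonneg[OF p] by (intro mult_mono) auto
    also have "\<dots> < 1" using padic_p_gt_1[OF p] by (simp add: inverse_less_1_iff)
    finally show False by simp
  qed
  hence "coprime b (int p ^ k)" using p
    by (metis coprime_commute coprime_power_right_iff prime_imp_coprime prime_nat_int_transfer)
  hence "gcd b (int p ^ k) = 1" by simp
  then obtain u v where uv: "u * b + v * int p ^ k = 1" using bezout_int[of b "int p ^ k"] by metis
  have pos: "0 < int p ^ k" using prime_gt_0_nat[OF p] by simp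
  define m where "m = nat (a * u mod int p ^ k)"
  have m: "int m = a * u mod int p ^ k" using pos by (simp add: m_def)
  have "int m < int (p ^ k)" using pos by (simp add: m)
  hence "m < p ^ k" by (simp only: of_nat_less_iff)
  moreover have "padic_abs p (q - of_nat m) \<le> inverse (real p ^ k)"
  proof -
    have "int p ^ k dvd a * u - int m" unfolding m by (rule dvd_minus_mod)
    hence "int p ^ k dvd a * v * int p ^ k + b * (a * u - int m)" by simp
    also have "a * v * int p ^ k + b * (a * u - int m) = a * (u * b + v * int p ^ k) - b * int m"
      by (simp add: algebra_simps)
    finally have "int p ^ k dvd a - b * int m" by (simp add: uv)
    hence "padic_abs p (of_int (a - b * int m)) \<le> inverse (real p ^ k)"
      by (rule padic_abs_of_int_le[OF p])
    moreover have "of_int (a - b * int m) = (q - of_nat m) * of_int b"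
      using q_eq \<open>b > 0\<close> by (simp add: left_diff_distrib)
    moreover have "1 \<le> padic_abs p (of_int b)" using padic_abs_of_int_ge[OF p, of 0 b] \<open>\<not> int p dvd b\<close> by simp
    ultimately show ?thesis
      using padic_abs_nonneg[OF p, of "q - of_nat m"]
        mult_left_mono[of 1 "padic_abs p (of_int b)" "padic_abs p (q - of_nat m)"]
      by (simp add: padic_abs_mult[OF p])
  qed
  ultimately show ?thesis by (intro exI[of _ m] conjI)
qed

text \<open>The integers modulo \<open>p ^ k\<close> number the balls of radius \<open>1 / p ^ k\<close> in the ring of p-adic integers.\<close>

lemma padic_integer_approx:
  fixes z :: "'p::prime_card padic"
  assumes "padic_norm z \<le> 1"
  shows "\<exists>m < CARD('p) ^ k. padic_norm (z - of_nat m) \<le> inverse (real CARD('p) ^ k)"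
proof -
  have p: "prime CARD('p)" by (rule prime_card)
  have p1: "1 < real CARD('p)" by (rule padic_p_gt_1[OF p])
  obtain q where "dist (of_rat q) z < inverse (real CARD('p) ^ k)"
    by (rule of_rat_dense_padic[of "inverse (real CARD('p) ^ k)" z]) (use p1 in auto)
  hence q: "padic_norm (of_rat q - z) < inverse (real CARD('p) ^ k)" by (simp add: dist_padic_def)
  also have le1: "inverse (real CARD('p) ^ k) \<le> 1" using p1 by (simp add: inverse_le_1_iff)
  finally have "padic_norm ((of_rat q - z) + z) \<le> 1"
    using padic_norm_add[of "of_rat q - z" z] assms by simp
  hence "padic_abs CARD('p) q \<le> 1" by (simp add: padic_norm_of_rat)
  from padic_abs_le_1_approx[OF p this, of k]
  obtain m where m: "m < CARD('p) ^ k" "padic_abs CARD('p) (q - of_nat m) \<le> inverse (real CARD('p) ^ k)"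
    by (elim exE conjE) (rule that)
  have "padic_norm (of_rat (q - of_nat m) :: 'p padic) \<le> inverse (real CARD('p) ^ k)"
    using m(2) by (simp only: padic_norm_of_rat)
  hence qm: "padic_norm (of_rat q - of_nat m :: 'p padic) \<le> inverse (real CARD('p) ^ k)"
    by (simp add: of_rat_diff)
  have "padic_norm ((z - of_rat q) + (of_rat q - of_nat m)) \<le> max (padic_norm (z - of_rat q)) (padic_norm (of_rat q - of_nat m :: 'p padic))"
    by (rule padic_norm_add)
  also have "padic_norm (z - of_rat q) = padic_norm (of_rat q - z)"
    using padic_norm_minus[of "of_rat q - z"] by simp
  finally have "padic_norm (z - of_nat m) \<le> inverse (real CARD('p) ^ k)" using q qm by simp
  thus ?thesis using m(1) by (intro exI[of _ m] conjI)
qed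

lemma padic_norm_1 [simp]: "padic_norm (1 :: 'p::prime_card padic) = 1"
  using padic_norm_mult[of "1 :: 'p padic" 1] padic_norm_eq_0_iff[of "1 :: 'p padic"] by simp

lemma padic_norm_power: "padic_norm ((x :: 'p::prime_card padic) ^ k) = padic_norm x ^ k"
  by (induction k) (simp_all add: padic_norm_mult)

lemma padic_norm_inverse: "padic_norm (inverse (x :: 'p::prime_card padic)) = inverse (padic_norm x)"
proof (cases "x = 0")
  case False
  hence "padic_norm x * padic_norm (inverse x) = 1" by (simp flip: padic_norm_mult)
  thus ?thesis by (rule inverse_unique[symmetric])
next
  case True
  have zero: "padic_norm (0 :: 'p padic) = 0" by simp
  show ?thesis by (simp add: True zero del: padic_norm_eq_0_iff)
qed

lemma exists_padic_norm_eq: "\<exists>u :: 'p::prime_card padic. padic_norm u = real CARD('p) powi k"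
proof -
  have p: "prime CARD('p)" by (rule prime_card)
  have "\<not> int CARD('p) ^ Suc 1 dvd int CARD('p)"
  proof
    assume "int CARD('p) ^ Suc 1 dvd int CARD('p)"
    hence "CARD('p) ^ Suc 1 dvd CARD('p)" by (simp only: of_nat_dvd_iff flip: of_nat_power)
    hence "CARD('p) ^ Suc 1 \<le> CARD('p)" by (rule dvd_imp_le) simp
    thus False using prime_gt_1_nat[OF p] by simp
  qed
  hence "padic_abs CARD('p) (of_int (int CARD('p))) = inverse (real CARD('p))"
    using padic_abs_of_int_ge[OF p, of 1 "int CARD('p)"] padic_abs_of_int_le[OF p, of 1 "int CARD('p)"]
    by (intro antisym) simp_all
  hence norm_p: "padic_norm (of_nat CARD('p) :: 'p padic) = inverse (real CARD('p))"
    using padic_norm_of_rat[of "of_nat CARD('p)", where 'p = 'p] by simp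
  show ?thesis
  proof (cases "k \<ge> 0")
    case True
    hence "padic_norm (inverse (of_nat CARD('p)) ^ nat k :: 'p padic) = real CARD('p) powi k"
      by (simp only: padic_norm_power padic_norm_inverse norm_p inverse_inverse_eq power_int_def if_True)
    thus ?thesis by (rule exI)
  next
    case False
    hence "padic_norm (of_nat CARD('p) ^ nat (- k) :: 'p padic) = real CARD('p) powi k"
      by (simp only: padic_norm_power norm_p power_int_def if_False)
    thus ?thesis by (rule exI)
  qed
qed

lemma powi_bracket:
  fixes b x :: real
  assumes "1 < b" "0 < x"
  shows "\<exists>k. b powi k \<le> x \<and> x < b powi (k + 1)"
proof (intro exI conjI)
  let ?k = "\<lfloor>log b x\<rfloor>"
  have powi: "b powi j = b powr real_of_int j" for j using assms by (simp add: powr_real_of_int')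
  have "b powr real_of_int ?k \<le> b powr log b x" using assms by (intro powr_mono) auto
  thus "b powi ?k \<le> x" using assms by (simp add: powi)
  have "b powr log b x < b powr real_of_int (?k + 1)" using assms by (intro powr_less_mono) linarith+
  thus "x < b powi (?k + 1)" using assms by (simp only: powi powr_log_cancel)
qed

text \<open>
  Scale a ball that contains \<open>cball a r\<close> to the p-adic integers and read off the residue modulo a power
  of \<open>p\<close>. Rounding \<open>r\<close> up and \<open>s\<close> strictly down to powers of \<open>p\<close> accounts for the factor \<open>p\<^sup>3\<close>.
\<close>

lemma padic_line_coverable: "line_coverable TYPE('p::prime_card padic) (real CARD('p) ^ 3)"
  unfolding line_coverable_def
proof (intro allI impI)
  fix a :: "'p padic" and r s :: real assume rs: "0 < s \<and> s \<le> r"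
  let ?p = "real CARD('p)"
  have p1: "1 < ?p" by (rule padic_p_gt_1[OF prime_card])
  obtain i where i: "?p powi i \<le> r" "r < ?p powi (i + 1)" using powi_bracket[OF p1, of r] rs by auto
  obtain j where j: "?p powi j \<le> s" "s < ?p powi (j + 1)" using powi_bracket[OF p1, of s] rs by auto
  have "?p powi j < ?p powi (i + 1)" using i j rs by linarith
  hence "j < i + 1" using p1 power_int_increasing[of "i + 1" j ?p] by (intro not_le_imp_less notI) simp
  define k where "k = nat (i + 1 - (j - 1))"
  have powi_k: "?p ^ k * ?p powi (j - 1) = ?p powi (i + 1)"
  proof -
    have "?p ^ k * ?p powi (j - 1) = ?p powi (int k + (j - 1))" using p1 by (subst power_int_add) auto
    also have "int k + (j - 1) = i + 1" using \<open>j < i + 1\<close> by (simp add: k_def)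
    finally show ?thesis .
  qed
  obtain u :: "'p padic" where u: "padic_norm u = ?p powi (- (i + 1))"
    using exists_padic_norm_eq[where 'p = 'p] by blast
  have u_scale: "padic_norm u * ?p powi (i + 1) = 1" using p1 by (simp add: u flip: power_int_add)
  have u_pos: "0 < padic_norm u" using p1 by (simp add: u)
  have "\<exists>m. x \<in> cball a r \<longrightarrow> m < CARD('p) ^ k \<and> padic_norm ((x - a) * u - of_nat m) \<le> inverse (?p ^ k)" for x
  proof (cases "x \<in> cball a r")
    case True
    hence "dist x a \<le> r" by (simp add: dist_commute)
    hence "padic_norm (x - a) \<le> ?p powi (i + 1)" using i(2) by (simp add: dist_padic_def)
    hence "padic_norm u * padic_norm (x - a) \<le> 1"
      unfolding u_scale[symmetric] using u_pos by simp
    hence "padic_norm ((x - a) * u) \<le> 1" by (simp add: padic_norm_mult mult.commute)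
    from padic_integer_approx[OF this, of k] show ?thesis by (elim exE, intro exI impI)
  qed simp
  then obtain f where f: "\<And>x. x \<in> cball a r \<longrightarrow> f x < CARD('p) ^ k \<and>
      padic_norm ((x - a) * u - of_nat (f x)) \<le> inverse (?p ^ k)" by metis
  have "?p powi (j - 1) < s"
  proof -
    have "?p powi (j - 1) < ?p powi j" using p1 by (intro power_int_strict_increasing) auto
    thus ?thesis using j(1) by simp
  qed
  have "dist x y < s" if "x \<in> cball a r" "y \<in> cball a r" "f x = f y" for x y
  proof -
    have fx: "padic_norm ((x - a) * u - of_nat (f x)) \<le> inverse (?p ^ k)" using f[of x] that(1) by simp
    have fy: "padic_norm ((y - a) * u - of_nat (f x)) \<le> inverse (?p ^ k)" using f[of y] that(2,3) by simp
    have "(x - y) * u = ((x - a) * u - of_nat (f x)) + (- ((y - a) * u - of_nat (f x)))"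
      by (simp add: algebra_simps)
    hence "padic_norm ((x - y) * u) \<le> inverse (?p ^ k)"
      using padic_norm_add[of "(x - a) * u - of_nat (f x)" "- ((y - a) * u - of_nat (f x))"] fx fy
      by (simp only: padic_norm_minus)
    hence "padic_norm (x - y) * padic_norm u \<le> inverse (?p ^ k)" by (simp only: padic_norm_mult)
    hence "padic_norm (x - y) * padic_norm u * ?p powi (i + 1) \<le> inverse (?p ^ k) * ?p powi (i + 1)"
      using p1 by (intro mult_right_mono) auto
    also have "\<dots> = ?p powi (j - 1)" using p1 by (simp flip: powi_k)
    also have "padic_norm (x - y) * padic_norm u * ?p powi (i + 1) = padic_norm (x - y)"
      using u_scale by (simp add: mult.assoc)
    finally show ?thesis using \<open>?p powi (j - 1) < s\<close> by (simp add: dist_padic_def)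
  qed
  moreover have "real (CARD('p) ^ k) \<le> ?p ^ 3 * (r / s)"
  proof -
    have split: "?p powi (j + 1) = ?p ^ 2 * ?p powi (j - 1)" "?p powi (i + 1) = ?p * ?p powi i"
      using p1 by (simp_all add: power_int_add power_int_diff power2_eq_square)
    have pos: "0 < ?p powi (j - 1)" using p1 by simp
    have "?p ^ k * s \<le> ?p ^ k * (?p ^ 2 * ?p powi (j - 1))" using j(2) p1 unfolding split by simp
    also have "\<dots> = ?p ^ 2 * (?p * ?p powi i)" using powi_k unfolding split by simp
    also have "\<dots> \<le> ?p ^ 2 * (?p * r)" using i(1) p1 by simp
    also have "\<dots> = ?p ^ 3 * r" by (simp add: power2_eq_square power3_eq_cube)
    finally show ?thesis using rs by (simp add: field_simps)
  qed
  ultimately show "\<exists>f N. real N \<le> ?p ^ 3 * (r / s) \<and> (\<forall>x\<in>cball a r. f x < N) \<and>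
      (\<forall>x\<in>cball a r. \<forall>y\<in>cball a r. f x = f y \<longrightarrow> dist x y < s)"
    using f by (intro exI[of _ f] exI[of _ "CARD('p) ^ k"]) simp
qed

text \<open>
  Distinct integers in \<open>{0..<p ^ m}\<close> differ by at least \<open>p / p ^ m\<close> in the p-adic absolute value, and
  they all lie in the unit ball, which is then scaled by \<open>u\<close> to fit into \<open>ball a \<eta>\<close>.
\<close>

lemma padic_line_packable: "line_packable TYPE('p::prime_card padic) (inverse (real CARD('p) ^ 2))"
  unfolding line_packable_def
proof (intro allI impI)
  fix a :: "'p padic" and \<eta> s :: real assume s: "0 < s \<and> s \<le> \<eta>"
  let ?p = "real CARD('p)"
  have p: "prime CARD('p)" by (rule prime_card)
  have p1: "1 < ?p" by (rule padic_p_gt_1[OF p])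
  obtain i where i: "?p powi i \<le> \<eta>" "\<eta> < ?p powi (i + 1)" using powi_bracket[OF p1, of \<eta>] s by auto
  obtain u :: "'p padic" where u: "padic_norm u = ?p powi (i - 1)"
    using exists_padic_norm_eq[where 'p = 'p] by blast
  have split: "?p powi (i + 1) = ?p ^ 2 * ?p powi (i - 1)" "?p powi i = ?p * ?p powi (i - 1)"
    using p1 by (simp_all add: power_int_add power_int_diff power2_eq_square)
  have u_pos: "0 < padic_norm u" using p1 by (simp add: u)
  have u_less: "padic_norm u < \<eta>"
  proof -
    have "padic_norm u < ?p powi i" unfolding split(2) using p1 u_pos by (simp add: u)
    thus ?thesis using i(1) by simp
  qed
  define y where "y = ?p * padic_norm u / s"
  have "0 < y" using p1 u_pos s by (simp add: y_def)
  then obtain l where l: "?p powi l \<le> y" "y < ?p powi (l + 1)" using powi_bracket[OF p1, of y] by auto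
  \<comment> \<open>If \<open>l\<close> is negative, then \<open>m = 0\<close> and a single point is already enough.\<close>
  define m where "m = nat l"
  define g where "g j = a + u * of_nat j" for j
  have "inverse (?p ^ 2) * (\<eta> / s) \<le> real (CARD('p) ^ m)"
  proof -
    have "\<eta> \<le> ?p ^ 2 * padic_norm u" using i(2) unfolding split u by simp
    hence "inverse (?p ^ 2) * (\<eta> / s) \<le> padic_norm u / s"
      using s p1 by (simp add: field_simps)
    also have "\<dots> = y / ?p" using p1 by (simp add: y_def)
    also have "\<dots> \<le> ?p powi l" using l(2) p1 by (simp add: power_int_add field_simps)
    also have "\<dots> \<le> ?p powi (int m)" using p1 by (intro power_int_increasing) (auto simp: m_def)
    finally show ?thesis by simp
  qed
  moreover have "g j \<in> ball a \<eta>" for j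
  proof -
    have "padic_norm (of_nat j :: 'p padic) \<le> 1"
      using padic_norm_of_rat[of "of_nat j", where 'p = 'p] padic_abs_of_int_le[OF p, of 0 "int j"] by simp
    hence "padic_norm u * padic_norm (of_nat j :: 'p padic) \<le> padic_norm u * 1"
      using u_pos by (intro mult_left_mono) auto
    thus ?thesis using u_less by (simp add: g_def dist_commute[of a] dist_padic_def padic_norm_mult)
  qed
  moreover have "s \<le> dist (g h) (g j)" if hj: "h < CARD('p) ^ m" "j < CARD('p) ^ m" "h \<noteq> j" for h j
  proof -
    obtain m' where m': "m = Suc m'" using hj by (cases m) auto
    have "\<not> int CARD('p) ^ Suc m' dvd int h - int j"
    proof
      assume "int CARD('p) ^ Suc m' dvd int h - int j"
      hence "int CARD('p) ^ m \<le> \<bar>int h - int j\<bar>" using hj(3) unfolding m' by (intro zdvd_imp_le) auto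
      moreover have "int h < int CARD('p) ^ m" "int j < int CARD('p) ^ m"
        using hj by (simp_all only: of_nat_less_iff flip: of_nat_power)
      ultimately show False by linarith
    qed
    hence "inverse (?p ^ m') \<le> padic_abs CARD('p) (of_int (int h - int j))"
      by (rule padic_abs_of_int_ge[OF p])
    also have "\<dots> = padic_norm (of_nat h - of_nat j :: 'p padic)"
      using padic_norm_of_rat[of "of_int (int h - int j)", where 'p = 'p] by (simp add: of_rat_diff)
    finally have "padic_norm u * inverse (?p ^ m') \<le> padic_norm (u * (of_nat h - of_nat j))"
      using u_pos by (simp add: padic_norm_mult)
    also have "\<dots> = dist (g h) (g j)" by (simp add: g_def dist_padic_def algebra_simps)
    finally have dist: "padic_norm u * inverse (?p ^ m') \<le> dist (g h) (g j)" .
    have "?p ^ m \<le> y" using l(1) m' by (simp add: m_def power_int_def split: if_splits)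
    hence "s * ?p ^ m' \<le> padic_norm u" using s p1 by (simp add: y_def m' field_simps)
    hence "s \<le> padic_norm u * inverse (?p ^ m')" using p1 by (simp add: field_simps)
    with dist show ?thesis by simp
  qed
  ultimately show "\<exists>g N. inverse (?p ^ 2) * (\<eta> / s) \<le> real N \<and> (\<forall>i<N. g i \<in> ball a \<eta>) \<and>
      (\<forall>i<N. \<forall>j<N. i \<noteq> j \<longrightarrow> s \<le> dist (g i) (g j))"
    by (intro exI[of _ g] exI[of _ "CARD('p) ^ m"]) simp
qed

section \<open>Square roots of half the dimension\<close>

theorem theorem6p5:
  fixes G :: "('g, 'b) monoid_scheme"
    and T :: "'g topology"
    and A :: "('g, real) chart set"
    and B :: "('g, 'p::prime_card padic) chart set"
    and d :: "'g \<Rightarrow> 'g \<Rightarrow> real"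
    and n :: nat
  assumes "compact_space T"
    and "(real_lie_group n G T A \<and> real_compatible_metric n G T A d) \<or>
         (padic_lie_group n G T B \<and> padic_compatible_metric n G T B d)"
  shows "\<exists>R. R \<subseteq> carrier G \<and> R <#>\<^bsub>G\<^esub> R = carrier G \<and>
             upper_minkowski_dim R d = ereal (real n / 2)"
  using assms(2)
proof
  assume *: "real_lie_group n G T A \<and> real_compatible_metric n G T A d"
  show ?thesis
    by (rule compact_lie_group_square_root[OF assms(1) conjunct1[OF *] conjunct2[OF *]
          coordinatewise_real real_line_coverable _ real_line_packable]) simp_all
next
  assume *: "padic_lie_group n G T B \<and> padic_compatible_metric n G T B d"
  have p1: "1 < real CARD('p)" by (rule padic_p_gt_1[OF prime_card])
  show ?thesis
    by (rule compact_lie_group_square_root[OF assms(1) conjunct1[OF *] conjunct2[OF *]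
          coordinatewise_padic padic_line_coverable _ padic_line_packable])
       (use p1 in simp_all)
qed

end
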